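(* Let $M\subset\mathbb{C}^{n+1}$ be a real hypersurface defined by $\varrho=0$, where $\varrho$ is a smooth real-valued defining function ($d\varrho\neq 0$ on $M$) with $\varrho_w\neq 0$ and with $\varrho_{j\bar k}=\delta_{jk}$ for $j,k=1,\dots,n+1$ (identically near $M$), and let $\theta=\iota^{*}(i\bar\partial\varrho)$, where $\iota:M\to\mathbb{C}^{n+1}$ is the inclusion. Put $h_{\alpha\beta}=D^{\varrho}_{\alpha\beta}(\varrho)$, $h_{\bar\beta\bar\sigma}=\overline{h_{\beta\sigma}}$ and $h^{\mu}_{\bar\beta}=h_{\bar\beta\bar\sigma}h^{\mu\bar\sigma}$. Then, in the local frame $Z_\alpha=\partial_\alpha-(\varrho_\alpha/\varrho_w)\,\partial_w$, $\alpha=1,\dots,n$, the pseudohermitian curvature and the Chern--Moser--Weyl tensor of $(M,\theta)$ are given by $$R_{\alpha\bar\beta\gamma\bar\sigma}=|\partial\varrho|^{-2}\left(h_{\alpha\bar\beta}h_{\gamma\bar\sigma}+h_{\alpha\bar\sigma}h_{\gamma\bar\beta}-h_{\alpha\gamma}h_{\bar\beta\bar\sigma}\right),$$ $$S_{\alpha\bar\beta\gamma\bar\sigma}=-\frac{h_{\alpha\gamma}h_{\bar\beta\bar\sigma}}{|\partial\varrho|^{2}}+\frac{h_{\mu\alpha}h^{\mu}_{\bar\beta}h_{\gamma\bar\sigma}+h_{\mu\gamma}h^{\mu}_{\bar\beta}h_{\alpha\bar\sigma}+h_{\mu\alpha}h^{\mu}_{\bar\sigma}h_{\gamma\bar\b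eta}+h_{\mu\gamma}h^{\mu}_{\bar\sigma}h_{\alpha\bar\beta}}{(n+2)|\partial\varrho|^{2}}-\frac{h_{\mu\nu}h^{\nu\mu}\left(h_{\alpha\bar\beta}h_{\gamma\bar\sigma}+h_{\alpha\bar\sigma}h_{\gamma\bar\beta}\right)}{(n+1)(n+2)|\partial\varrho|^{2}}.$$
   Context: Coordinates on $\mathbb{C}^{n+1}$ are $(z_1,\dots,z_n,z_{n+1})$ with $w=z_{n+1}$. Greek indices run over $1,\dots,n$, lowercase Latin indices over $1,\dots,n+1$, and repeated indices are summed. Subscripts on $\varrho$ denote partial derivatives: $\varrho_j=\partial\varrho/\partial z_j$, $\varrho_{\bar k}=\partial\varrho/\partial\bar z_k$, $\varrho_{j\bar k}=\partial^2\varrho/\partial z_j\partial\bar z_k$, $\varrho_w=\partial\varrho/\partial w$. The vector fields $Z_\alpha$ form a local basis of $T^{1,0}M$; $Z_{\bar\alpha}=\overline{Z_\alpha}$. Here $|\partial\varrho|^2=\varrho^{j\bar k}\varrho_j\varrho_{\bar k}$ is the squared norm of $\partial\varrho$ in the Kähler metric $\omega=i\partial\bar\partial\varrho$ ($\varrho^{j\bar k}$ the inverse of $\varrho_{j\bar k}$); since $\varrho_{j\bar k}=\delta_{jk}$ it equals $\sum_{j=1}^{n+1}|\varrho_j|^2$. The Levi matrix is $h_{\alpha\bar\beta}=-i\,d\theta(Z_\alpha,Z_{\bar\beta})=\varrho_{j\bar k}Z_\alpha^jZ_{\bar\beta}^{\bar k}$, with inverse $h^{\alpha\bar\beta}$ (also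 written $h^{\bar\beta\alpha}$); these are used to lower and raise Greek indices. In particular $h^{\mu\nu}=h_{\bar\beta\bar\sigma}h^{\mu\bar\sigma}h^{\nu\bar\beta}$. The second order operator $D^{\varrho}_{\alpha\beta}$ is $$D^{\varrho}_{\alpha\beta}=\partial_\alpha\partial_\beta-\frac{\varrho_\alpha}{\varrho_w}\partial_w\partial_\beta-\frac{\varrho_\beta}{\varrho_w}\partial_w\partial_\alpha+\frac{\varrho_\alpha\varrho_\beta}{\varrho_w^2}\partial_w^2 .$$ $T$ is the real vector field on $M$ with $\theta(T)=1$ and $T\,\rfloor\,d\theta=0$. The Tanaka--Webster connection $\nabla$ of $(M,\theta)$ is the unique linear connection that preserves $T^{1,0}M$, has $\theta$ and $d\theta$ parallel, and whose torsion $\mathbb{T}_\nabla(X,Y)=\nabla_XY-\nabla_YX-[X,Y]$ satisfies $\mathbb{T}_\nabla(Z_\alpha,Z_\beta)=0$, $\mathbb{T}_\nabla(Z_\alpha,Z_{\bar\beta})=ih_{\alpha\bar\beta}T$ and $\mathbb{T}_\nabla(T,Z_\alpha)\in T^{0,1}M$. With $R(X,Y)Z=\nabla_X\nabla_YZ-\nabla_Y\nabla_XZ-\nabla_{[X,Y]}Z$, the pseudohermitian curvature is $R_{\alpha\bar\beta\gamma\bar\sigma}=\langle R(Z_\alpha,Z_{\bar\beta})Z_\gamma,Z_{\bar\sigma}\rangle$, where $\langle Z_\alpha,Z_{\bar\beta}\rangle=h_{\alpha\bar\beta}$ is extended complex bilinearly. The Ricci tensor is $R_{\gamma\bar\sigma}=h^{\alpha\bar\beta}R_{\alpha\bar\beta\gamma\bar\sigma}$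 and the Webster scalar curvature is $R=h^{\gamma\bar\sigma}R_{\gamma\bar\sigma}$. The Chern--Moser--Weyl tensor is the completely tracefree part of the curvature: $$S_{\alpha\bar\beta\gamma\bar\sigma}=R_{\alpha\bar\beta\gamma\bar\sigma}-\frac{R_{\alpha\bar\beta}h_{\gamma\bar\sigma}+R_{\gamma\bar\beta}h_{\alpha\bar\sigma}+R_{\alpha\bar\sigma}h_{\gamma\bar\beta}+R_{\gamma\bar\sigma}h_{\alpha\bar\beta}}{n+2}+\frac{R\,(h_{\alpha\bar\beta}h_{\gamma\bar\sigma}+h_{\alpha\bar\sigma}h_{\gamma\bar\beta})}{(n+1)(n+2)}.$$ *)

theory Defs
  imports "HOL-Analysis.Analysis"
begin

section \<open>Smooth functions and Wirtinger derivatives\<close>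

text \<open>Meant for open \<open>S\<close>, where it is the usual class \<open>C\<^sup>k\<close> on finite-dimensional spaces.\<close>

primrec Ck_on :: "nat \<Rightarrow> 'a::real_normed_vector set \<Rightarrow> ('a \<Rightarrow> 'b::real_normed_vector) \<Rightarrow> bool" where
  "Ck_on 0 S f \<longleftrightarrow> continuous_on S f"
| "Ck_on (Suc k) S f \<longleftrightarrow>
     (\<forall>x\<in>S. f differentiable (at x)) \<and> (\<forall>v. Ck_on k S (\<lambda>x. frechet_derivative f (at x) v))"

definition smooth_on :: "'a::real_normed_vector set \<Rightarrow> ('a \<Rightarrow> 'b::real_normed_vector) \<Rightarrow> bool" where
  "smooth_on S f \<longleftrightarrow> (\<forall>k. Ck_on k S f)"

text \<open>Smoothness of a function on a subset \<open>M\<close> that need not be open: local smooth extendability.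
  Values of \<open>f\<close> off \<open>M\<close> are irrelevant.\<close>

definition smooth_along :: "'a::real_normed_vector set \<Rightarrow> ('a \<Rightarrow> 'b::real_normed_vector) \<Rightarrow> bool" where
  "smooth_along M f \<longleftrightarrow>
     (\<forall>p\<in>M. \<exists>V F. open V \<and> p \<in> V \<and> smooth_on V F \<and> (\<forall>q\<in>V \<inter> M. F q = f q))"

definition dz :: "'m \<Rightarrow> (complex^'m::finite \<Rightarrow> complex) \<Rightarrow> complex^'m \<Rightarrow> complex" where
  "dz j f p = (frechet_derivative f (at p) (axis j 1) - \<i> * frechet_derivative f (at p) (axis j \<i>)) / 2"

definition dzbar :: "'m \<Rightarrow> (complex^'m::finite \<Rightarrow> complex) \<Rightarrow> complex^'m \<Rightarrow> complex" where
  "dzbar j f p = (frechet_derivative f (at p) (axis j 1) + \<i> * frechet_derivative f (at p) (axis j \<i>)) / 2"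

abbreviation cpx :: "('a \<Rightarrow> real) \<Rightarrow> 'a \<Rightarrow> complex" where
  "cpx f \<equiv> (\<lambda>p. complex_of_real (f p))"

text \<open>\<open>|\<partial>\<rho>|\<^sup>2 = \<rho>\<^sup>j\<^sup>k \<rho>\<^sub>j \<rho>\<^sub>k\<close> (second index barred).  With
  \<open>G $ j $ k = \<rho>\<^sub>j\<^sub>k\<close> the entry with upper indices \<open>j\<close>, \<open>k\<close>-bar of the inverse is
  \<open>matrix_inv G $ k $ j\<close>.\<close>

definition grad_norm2 :: "(complex^'m::finite \<Rightarrow> real) \<Rightarrow> complex^'m \<Rightarrow> complex" where
  "grad_norm2 \<rho> p =
     (\<Sum>j\<in>UNIV. \<Sum>k\<in>UNIV.
        matrix_inv (\<chi> j k. dz j (dzbar k (cpx \<rho>)) p) $ k $ j * dz j (cpx \<rho>) p * dzbar k (cpx \<rho>) p)"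

section \<open>Complex vector fields on a real hypersurface\<close>

text \<open>A vector of the complexified tangent space of \<open>\<complex>\<^sup>m\<close> is written in the basis
  \<open>\<partial>/\<partial>z\<^sub>j\<close> (index \<open>Inl j\<close>), \<open>\<partial>/\<partial>z\<^sub>j\<close>-bar (index \<open>Inr j\<close>).  The real
  vector \<open>u \<in> \<complex>\<^sup>m\<close> has components \<open>u\<^sub>j\<close> and \<open>cnj u\<^sub>j\<close>.  Fields on \<open>M\<close> are total functions
  of which only the values on \<open>M\<close> matter.\<close>

type_synonym 'm cvec = "(complex, 'm + 'm) vec"
type_synonym 'm cfield = "(complex, 'm) vec \<Rightarrow> 'm cvec"

definition vconj :: "'m::finite cvec \<Rightarrow> 'm cvec" where
  "vconj v = (\<chi> i. case i of Inl j \<Rightarrow> cnj (v $ Inr j) | Inr j \<Rightarrow> cnj (v $ Inl j))"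

definition fconj :: "'m::finite cfield \<Rightarrow> 'm cfield" where
  "fconj X = (\<lambda>p. vconj (X p))"

text \<open>\<open>v = re_vec v + \<i> im_vec v\<close> for real vectors \<open>re_vec v\<close>, \<open>im_vec v\<close>.\<close>

definition re_vec :: "'m::finite cvec \<Rightarrow> complex^'m" where
  "re_vec v = (\<chi> j. (v $ Inl j + cnj (v $ Inr j)) / 2)"

definition im_vec :: "'m::finite cvec \<Rightarrow> complex^'m" where
  "im_vec v = (\<chi> j. (v $ Inl j - cnj (v $ Inr j)) / (2 * \<i>))"

text \<open>The function \<open>X f\<close> on \<open>M\<close>.  The derivative of \<open>f\<close> within a hypersurface \<open>M\<close> is determined only
  on vectors tangent to \<open>M\<close>; \<open>act\<close> is used only for \<open>X\<close> tangent to \<open>M\<close>.\<close>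

definition act ::
  "(complex^'m::finite) set \<Rightarrow> 'm cfield \<Rightarrow> (complex^'m \<Rightarrow> complex) \<Rightarrow> complex^'m \<Rightarrow> complex" where
  "act M X f p =
     (let D = frechet_derivative f (at p within M) in D (re_vec (X p)) + \<i> * D (im_vec (X p)))"

definition bracket :: "(complex^'m::finite) set \<Rightarrow> 'm cfield \<Rightarrow> 'm cfield \<Rightarrow> 'm cfield" where
  "bracket M X Y p = (\<chi> i. act M X (\<lambda>q. Y q $ i) p - act M Y (\<lambda>q. X q $ i) p)"

text \<open>Smooth sections of the complexified tangent bundle of \<open>M = {\<rho> = 0}\<close>: smooth fields along \<open>M\<close>
  annihilated by \<open>d\<rho>\<close>.\<close>

definition vfield :: "(complex^'m::finite) set \<Rightarrow> (complex^'m \<Rightarrow> real) \<Rightarrow> 'm cfield \<Rightarrow> bool" where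
  "vfield M \<rho> X \<longleftrightarrow> smooth_along M X \<and>
     (\<forall>p\<in>M. (\<Sum>j\<in>UNIV. dz j (cpx \<rho>) p * X p $ Inl j + dzbar j (cpx \<rho>) p * X p $ Inr j) = 0)"

definition vfield10 :: "(complex^'m::finite) set \<Rightarrow> (complex^'m \<Rightarrow> real) \<Rightarrow> 'm cfield \<Rightarrow> bool" where
  "vfield10 M \<rho> X \<longleftrightarrow> vfield M \<rho> X \<and> (\<forall>p\<in>M. \<forall>j. X p $ Inr j = 0)"

definition vfield01 :: "(complex^'m::finite) set \<Rightarrow> (complex^'m \<Rightarrow> real) \<Rightarrow> 'm cfield \<Rightarrow> bool" where
  "vfield01 M \<rho> X \<longleftrightarrow> vfield M \<rho> X \<and> (\<forall>p\<in>M. \<forall>j. X p $ Inl j = 0)"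

type_synonym 'm oneform = "(complex, 'm) vec \<Rightarrow> 'm cvec \<Rightarrow> complex"

text \<open>Exterior derivative without the factor \<open>1/2\<close>.\<close>

definition ext_deriv ::
  "(complex^'m::finite) set \<Rightarrow> 'm oneform \<Rightarrow> 'm cfield \<Rightarrow> 'm cfield \<Rightarrow> complex^'m \<Rightarrow> complex" where
  "ext_deriv M \<theta> X Y p =
     act M X (\<lambda>q. \<theta> q (Y q)) p - act M Y (\<lambda>q. \<theta> q (X q)) p - \<theta> p (bracket M X Y p)"

section \<open>Pseudohermitian geometry\<close>

definition reeb_field ::
  "(complex^'m::finite) set \<Rightarrow> (complex^'m \<Rightarrow> real) \<Rightarrow> 'm oneform \<Rightarrow> 'm cfield \<Rightarrow> bool" where
  "reeb_field M \<rho> \<theta> T \<longleftrightarrow> vfield M \<rho> T \<and>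
     (\<forall>p\<in>M. vconj (T p) = T p) \<and>
     (\<forall>p\<in>M. \<theta> p (T p) = 1) \<and>
     (\<forall>X. vfield M \<rho> X \<longrightarrow> (\<forall>p\<in>M. ext_deriv M \<theta> T X p = 0))"

type_synonym 'm connection = "'m cfield \<Rightarrow> 'm cfield \<Rightarrow> 'm cfield"

text \<open>Linear connections on \<open>TM\<close>, extended complex linearly to the complexified tangent bundle; the
  last condition says that the extension comes from a connection on real fields.\<close>

definition linear_connection ::
  "(complex^'m::finite) set \<Rightarrow> (complex^'m \<Rightarrow> real) \<Rightarrow> 'm connection \<Rightarrow> bool" where
  "linear_connection M \<rho> nab \<longleftrightarrow>
     (\<forall>X Y. vfield M \<rho> X \<longrightarrow> vfield M \<rho> Y \<longrightarrow> vfield M \<rho> (nab X Y)) \<and>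
     (\<forall>X X' Y. vfield M \<rho> X \<longrightarrow> vfield M \<rho> X' \<longrightarrow> vfield M \<rho> Y \<longrightarrow>
        (\<forall>p\<in>M. nab (\<lambda>q. X q + X' q) Y p = nab X Y p + nab X' Y p)) \<and>
     (\<forall>f X Y. smooth_along M f \<longrightarrow> vfield M \<rho> X \<longrightarrow> vfield M \<rho> Y \<longrightarrow>
        (\<forall>p\<in>M. nab (\<lambda>q. f q *s X q) Y p = f p *s nab X Y p)) \<and>
     (\<forall>X Y Y'. vfield M \<rho> X \<longrightarrow> vfield M \<rho> Y \<longrightarrow> vfield M \<rho> Y' \<longrightarrow>
        (\<forall>p\<in>M. nab X (\<lambda>q. Y q + Y' q) p = nab X Y p + nab X Y' p)) \<and>
     (\<forall>f X Y. smooth_along M f \<longrightarrow> vfield M \<rho> X \<longrightarrow> vfield M \<rho> Y \<longrightarrow>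
        (\<forall>p\<in>M. nab X (\<lambda>q. f q *s Y q) p = act M X f p *s Y p + f p *s nab X Y p)) \<and>
     (\<forall>X Y. vfield M \<rho> X \<longrightarrow> vfield M \<rho> Y \<longrightarrow>
        (\<forall>p\<in>M. nab (fconj X) (fconj Y) p = vconj (nab X Y p)))"

definition torsion ::
  "(complex^'m::finite) set \<Rightarrow> 'm connection \<Rightarrow> 'm cfield \<Rightarrow> 'm cfield \<Rightarrow> 'm cfield" where
  "torsion M nab X Y p = nab X Y p - nab Y X p - bracket M X Y p"

definition curvature ::
  "(complex^'m::finite) set \<Rightarrow> 'm connection \<Rightarrow> 'm cfield \<Rightarrow> 'm cfield \<Rightarrow> 'm cfield \<Rightarrow> 'm cfield" where
  "curvature M nab X Y Z p = nab X (nab Y Z) p - nab Y (nab X Z) p - nab (bracket M X Y) Z p"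

text \<open>The Levi pairing of a \<open>(1,0)\<close> field with a \<open>(0,1)\<close> field.\<close>

definition levi_pair ::
  "(complex^'m::finite) set \<Rightarrow> 'm oneform \<Rightarrow> 'm cfield \<Rightarrow> 'm cfield \<Rightarrow> complex^'m \<Rightarrow> complex" where
  "levi_pair M \<theta> X Y p = - \<i> * ext_deriv M \<theta> X Y p"

definition tanaka_webster ::
  "(complex^'m::finite) set \<Rightarrow> (complex^'m \<Rightarrow> real) \<Rightarrow> 'm oneform \<Rightarrow> 'm cfield \<Rightarrow> 'm connection \<Rightarrow> bool" where
  "tanaka_webster M \<rho> \<theta> T nab \<longleftrightarrow>
     linear_connection M \<rho> nab \<and>
     (\<forall>X Y. vfield M \<rho> X \<longrightarrow> vfield10 M \<rho> Y \<longrightarrow> vfield10 M \<rho> (nab X Y)) \<and>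
     (\<forall>X Y. vfield M \<rho> X \<longrightarrow> vfield M \<rho> Y \<longrightarrow>
        (\<forall>p\<in>M. act M X (\<lambda>q. \<theta> q (Y q)) p = \<theta> p (nab X Y p))) \<and>
     (\<forall>X Y Z. vfield M \<rho> X \<longrightarrow> vfield M \<rho> Y \<longrightarrow> vfield M \<rho> Z \<longrightarrow>
        (\<forall>p\<in>M. act M X (ext_deriv M \<theta> Y Z) p =
                 ext_deriv M \<theta> (nab X Y) Z p + ext_deriv M \<theta> Y (nab X Z) p)) \<and>
     (\<forall>X Y. vfield10 M \<rho> X \<longrightarrow> vfield10 M \<rho> Y \<longrightarrow> (\<forall>p\<in>M. torsion M nab X Y p = 0)) \<and>
     (\<forall>X Y. vfield10 M \<rho> X \<longrightarrow> vfield01 M \<rho> Y \<longrightarrow>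
        (\<forall>p\<in>M. torsion M nab X Y p = (\<i> * levi_pair M \<theta> X Y p) *s T p)) \<and>
     (\<forall>X. vfield10 M \<rho> X \<longrightarrow> vfield01 M \<rho> (torsion M nab T X))"

text \<open>Components in a frame \<open>Z :: 'k \<Rightarrow> 'm cfield\<close> of \<open>T\<^sup>1\<^sup>,\<^sup>0M\<close>.  In the argument lists below,
  \<open>\<beta>\<close> and \<open>\<sigma>\<close> stand for barred indices.\<close>

definition levi ::
  "(complex^'m::finite) set \<Rightarrow> 'm oneform \<Rightarrow> ('k \<Rightarrow> 'm cfield) \<Rightarrow> 'k \<Rightarrow> 'k \<Rightarrow> complex^'m \<Rightarrow> complex" where
  "levi M \<theta> Z \<alpha> \<beta> p = levi_pair M \<theta> (Z \<alpha>) (fconj (Z \<beta>)) p"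

text \<open>Normalised by \<open>(\<Sum>\<beta>. levi M \<theta> Z \<alpha> \<beta> p * levi_inv M \<theta> Z \<gamma> \<beta> p) = \<delta>\<close>, hence the transposition.\<close>

definition levi_inv ::
  "(complex^'m::finite) set \<Rightarrow> 'm oneform \<Rightarrow> ('k::finite \<Rightarrow> 'm cfield) \<Rightarrow> 'k \<Rightarrow> 'k \<Rightarrow> complex^'m \<Rightarrow> complex" where
  "levi_inv M \<theta> Z \<alpha> \<beta> p = matrix_inv (\<chi> \<mu> \<nu>. levi M \<theta> Z \<mu> \<nu> p) $ \<beta> $ \<alpha>"

definition ph_curv ::
  "(complex^'m::finite) set \<Rightarrow> 'm oneform \<Rightarrow> 'm connection \<Rightarrow> ('k \<Rightarrow> 'm cfield) \<Rightarrow>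
     'k \<Rightarrow> 'k \<Rightarrow> 'k \<Rightarrow> 'k \<Rightarrow> complex^'m \<Rightarrow> complex" where
  "ph_curv M \<theta> nab Z \<alpha> \<beta> \<gamma> \<sigma> p =
     levi_pair M \<theta> (curvature M nab (Z \<alpha>) (fconj (Z \<beta>)) (Z \<gamma>)) (fconj (Z \<sigma>)) p"

definition ph_ricci ::
  "(complex^'m::finite) set \<Rightarrow> 'm oneform \<Rightarrow> 'm connection \<Rightarrow> ('k::finite \<Rightarrow> 'm cfield) \<Rightarrow>
     'k \<Rightarrow> 'k \<Rightarrow> complex^'m \<Rightarrow> complex" where
  "ph_ricci M \<theta> nab Z \<gamma> \<sigma> p =
     (\<Sum>\<alpha>\<in>UNIV. \<Sum>\<beta>\<in>UNIV. levi_inv M \<theta> Z \<alpha> \<beta> p * ph_curv M \<theta> nab Z \<alpha> \<beta> \<gamma> \<sigma> p)"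

definition webster_scalar ::
  "(complex^'m::finite) set \<Rightarrow> 'm oneform \<Rightarrow> 'm connection \<Rightarrow> ('k::finite \<Rightarrow> 'm cfield) \<Rightarrow>
     complex^'m \<Rightarrow> complex" where
  "webster_scalar M \<theta> nab Z p =
     (\<Sum>\<gamma>\<in>UNIV. \<Sum>\<sigma>\<in>UNIV. levi_inv M \<theta> Z \<gamma> \<sigma> p * ph_ricci M \<theta> nab Z \<gamma> \<sigma> p)"

definition chern_moser ::
  "(complex^'m::finite) set \<Rightarrow> 'm oneform \<Rightarrow> 'm connection \<Rightarrow> ('k::finite \<Rightarrow> 'm cfield) \<Rightarrow>
     'k \<Rightarrow> 'k \<Rightarrow> 'k \<Rightarrow> 'k \<Rightarrow> complex^'m \<Rightarrow> complex" where
  "chern_moser M \<theta> nab Z \<alpha> \<beta> \<gamma> \<sigma> p =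
     (let n = of_nat CARD('k);
          h = (\<lambda>\<alpha> \<beta>. levi M \<theta> Z \<alpha> \<beta> p);
          Ric = (\<lambda>\<alpha> \<beta>. ph_ricci M \<theta> nab Z \<alpha> \<beta> p)
      in ph_curv M \<theta> nab Z \<alpha> \<beta> \<gamma> \<sigma> p
         - (Ric \<alpha> \<beta> * h \<gamma> \<sigma> + Ric \<gamma> \<beta> * h \<alpha> \<sigma> + Ric \<alpha> \<sigma> * h \<gamma> \<beta> + Ric \<gamma> \<sigma> * h \<alpha> \<beta>) / (n + 2)
         + webster_scalar M \<theta> nab Z p * (h \<alpha> \<beta> * h \<gamma> \<sigma> + h \<alpha> \<sigma> * h \<gamma> \<beta>) / ((n + 1) * (n + 2)))"

section \<open>The graph frame and the operator \<open>D\<^sup>\<rho>\<close>\<close>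

text \<open>Coordinates on \<open>\<complex>\<^sup>n\<^sup>+\<^sup>1\<close> are indexed by \<open>'n option\<close>: \<open>Some \<alpha>\<close> is the coordinate
  \<open>z\<^sub>\<alpha>\<close> and \<open>None\<close> is \<open>w = z\<^sub>n\<^sub>+\<^sub>1\<close>.\<close>

definition cr_frame :: "((complex, 'n::finite option) vec \<Rightarrow> real) \<Rightarrow> 'n \<Rightarrow> 'n option cfield" where
  "cr_frame \<rho> \<alpha> p =
     axis (Inl (Some \<alpha>)) 1 - (dz (Some \<alpha>) (cpx \<rho>) p / dz None (cpx \<rho>) p) *s axis (Inl None) 1"

definition D_op ::
  "((complex, 'n::finite option) vec \<Rightarrow> real) \<Rightarrow> 'n \<Rightarrow> 'n \<Rightarrow>
     ((complex, 'n option) vec \<Rightarrow> complex) \<Rightarrow> (complex, 'n option) vec \<Rightarrow> complex" where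
  "D_op \<rho> \<alpha> \<beta> f p =
     (let r = (\<lambda>j. dz j (cpx \<rho>) p)
      in dz (Some \<alpha>) (dz (Some \<beta>) f) p
         - r (Some \<alpha>) / r None * dz None (dz (Some \<beta>) f) p
         - r (Some \<beta>) / r None * dz None (dz (Some \<alpha>) f) p
         + r (Some \<alpha>) * r (Some \<beta>) / (r None)\<^sup>2 * dz None (dz None f) p)"

end

theory Submission
  imports Defs
begin

text \<open>The Tanaka--Webster connection is expressed through the flat derivative \<open>D\<close> of
  \<open>\<complex>\<^sup>n\<^sup>+\<^sup>1\<close>, whose second derivatives commute; the curvature is then what remains of the
  correction terms.

  Because \<open>\<rho>\<^sub>j\<^sub>k = \<delta>\<^sub>j\<^sub>k\<close> (second index barred), \<open>d\<theta>\<close> is the restriction of the flat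
  Kaehler form and the Levi form \<open>h\<close> is the standard Hermitian product of \<open>\<complex>\<^sup>n\<^sup>+\<^sup>1\<close>
  (\<open>ext_deriv_theta\<close>, \<open>levi_pair_theta\<close>). Put \<open>\<nu>\<^sub>j = cnj \<rho>\<^sub>j / |\<partial>\<rho>|\<^sup>2\<close>: this vector
  spans the orthogonal complement of \<open>T\<^sup>1\<^sup>,\<^sup>0M\<close>, satisfies \<open>\<Sum>\<rho>\<^sub>j \<nu>\<^sub>j = 1\<close>, and the
  \<open>(1,0)\<close> part of the Reeb field is \<open>\<i> \<nu>\<close> (\<open>T_nth\<close>). The torsion of a pair consisting of a
  \<open>(1,0)\<close> and a \<open>(0,1)\<close> field determines \<open>\<nabla>\<close> of a \<open>(1,0)\<close> field in \<open>(0,1)\<close>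
  directions, and parallelism of \<open>d\<theta>\<close> then determines it in \<open>(1,0)\<close> directions. Both times
  the answer is the flat derivative projected to \<open>T\<^sup>1\<^sup>,\<^sup>0M\<close> along \<open>\<nu>\<close>
  (\<open>nab_projection_01\<close>, \<open>nab_projection_10\<close>). Since \<open>T\<close> is parallel, the remaining torsion
  axiom gives \<open>\<nabla>\<^sub>T V = D\<^sub>T V - \<i> D\<^sub>V \<nu>\<close> on \<open>(1,0)\<close> fields \<open>V\<close> (\<open>nab_T\<close>).

  For \<open>(1,0)\<close> fields \<open>X\<close>, \<open>Y\<close>, \<open>V\<close>, with \<open>Y'\<close> the conjugate of \<open>Y\<close> and
  \<open>H(X,V) = \<Sum>(X \<rho>\<^sub>k) V\<^sub>k\<close>, this gives, modulo \<open>\<nu>\<close>,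
  \<open>R(X,Y')V = h(V,Y') D\<^sub>X \<nu> - H(X,V) D\<^sub>Y\<^sub>' \<nu> + h(X,Y') D\<^sub>V \<nu>\<close>.
  The first two terms come from differentiating the projections (\<open>pair_nab_nab\<close>), the third from
  the component of \<open>[X,Y']\<close> along \<open>T\<close> (\<open>pair_nab_bracket\<close>). Modulo \<open>\<nu>\<close>, the vector
  \<open>D\<^sub>X \<nu>\<close> is \<open>X / |\<partial>\<rho>|\<^sup>2\<close>, and pairing \<open>D\<^sub>Y\<^sub>' \<nu>\<close> with a conjugate field \<open>W'\<close>
  gives the conjugate of \<open>H(Y,W)\<close> divided by \<open>|\<partial>\<rho>|\<^sup>2\<close>. Pairing \<open>R(X,Y')V\<close> with
  \<open>W'\<close>, which annihilates \<open>\<nu>\<close>, yields the curvature (\<open>levi_pair_curvature\<close>); on the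
  frame, \<open>H\<close> is \<open>D\<^sup>\<rho>\<^sub>\<alpha>\<^sub>\<beta> \<rho>\<close> (\<open>hess_Z\<close>). The Chern--Moser--Weyl tensor follows by
  taking traces: the terms containing only \<open>h\<close> cancel, and those with the Hessian are left
  (\<open>tracefree_part_eq\<close>).

  Fields live on \<open>M\<close> only, and derivatives of functions are taken within \<open>M\<close>. The analytic
  part shows that such a derivative is well defined on tangent vectors
  (\<open>has_derivative_within_hypersurface_unique\<close>), so that it may be computed with Wirtinger
  derivatives of an arbitrary local extension (\<open>act_eq\<close>).\<close>

section \<open>Calculus of the classes \<open>C\<^sup>k\<close>\<close>

text \<open>The derivative at a point only depends on the function near that point, hence \<open>S\<close> must be open;
  this is what allows the derivatives in the recursive definition to be replaced by explicit
  formulas.\<close>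

lemma Ck_on_cong:
  assumes "open S" "\<And>x. x \<in> S \<Longrightarrow> f x = g x" "Ck_on k S f"
  shows "Ck_on k S g"
  using assms(2,3)
proof (induction k arbitrary: f g)
  case 0
  then show ?case by (simp cong: continuous_on_cong)
next
  case (Suc k)
  have *: "(g has_derivative frechet_derivative f (at x)) (at x)" if "x \<in> S" for x
    using Suc.prems that assms(1)
    by (intro has_derivative_transform_within_open[of f _ x UNIV S g]) (auto simp: frechet_derivative_works[symmetric])
  then have "frechet_derivative g (at x) = frechet_derivative f (at x)" if "x \<in> S" for x
    using that frechet_derivative_at by metis
  then show ?case
    using * Suc.IH[of "\<lambda>x. frechet_derivative f (at x) v" "\<lambda>x. frechet_derivative g (at x) v" for v]
      Suc.prems by (auto simp: differentiable_def)
qed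

lemma Ck_on_SucI:
  assumes "open S" "\<And>x. x \<in> S \<Longrightarrow> (f has_derivative D x) (at x)" "\<And>v. Ck_on k S (\<lambda>x. D x v)"
  shows "Ck_on (Suc k) S f"
proof -
  have "frechet_derivative f (at x) = D x" if "x \<in> S" for x
    using frechet_derivative_at[OF assms(2)[OF that]] by simp
  then have "Ck_on k S (\<lambda>x. frechet_derivative f (at x) v)" for v
    using Ck_on_cong[OF assms(1) _ assms(3)[of v]] by simp
  then show ?thesis using assms(2) by (auto simp: differentiable_def)
qed

lemma Ck_on_SucD:
  assumes "Ck_on (Suc k) S f"
  shows "x \<in> S \<Longrightarrow> (f has_derivative frechet_derivative f (at x)) (at x)"
    and "Ck_on k S (\<lambda>x. frechet_derivative f (at x) v)"
  using assms by (auto simp: frechet_derivative_works[symmetric])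

lemma Ck_on_Suc_imp: "Ck_on (Suc k) S f \<Longrightarrow> Ck_on k S f"
proof (induction k arbitrary: f)
  case 0
  then show ?case
    by (auto intro!: continuous_at_imp_continuous_on differentiable_imp_continuous_within)
next
  case (Suc k)
  then show ?case by (meson Ck_on.simps(2))
qed

lemma Ck_on_subset: "Ck_on k S f \<Longrightarrow> T \<subseteq> S \<Longrightarrow> Ck_on k T f"
  by (induction k arbitrary: f) (auto intro: continuous_on_subset)

lemma Ck_on_const: "Ck_on k S (\<lambda>x. c)"
  by (induction k arbitrary: c) auto

lemma Ck_on_add:
  assumes "open S" "Ck_on k S f" "Ck_on k S g"
  shows "Ck_on k S (\<lambda>x. f x + g x)"
  using assms(2,3)
proof (induction k arbitrary: f g)
  case 0
  then show ?case by (simp add: continuous_on_add)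
next
  case (Suc k)
  note f = Ck_on_SucD[OF Suc.prems(1)] and g = Ck_on_SucD[OF Suc.prems(2)]
  show ?case
    by (rule Ck_on_SucI[OF assms(1) has_derivative_add[OF f(1) g(1)] Suc.IH[OF f(2) g(2)]])
qed

lemma Ck_on_linear:
  assumes "open S" "bounded_linear h" "Ck_on k S f"
  shows "Ck_on k S (\<lambda>x. h (f x))"
  using assms(3)
proof (induction k arbitrary: f)
  case 0
  then show ?case using bounded_linear.continuous_on[OF assms(2)] by auto
next
  case (Suc k)
  note f = Ck_on_SucD[OF Suc.prems]
  show ?case
    by (rule Ck_on_SucI[OF assms(1) bounded_linear.has_derivative[OF assms(2) f(1)] Suc.IH[OF f(2)]])
qed

text \<open>The two factors lose a derivative in turn, so the induction hypothesis is also used for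
  the undifferentiated factor at the lower order.\<close>

lemma Ck_on_mult:
  fixes f g :: "'a::real_normed_vector \<Rightarrow> 'b::real_normed_algebra"
  assumes "open S" "Ck_on k S f" "Ck_on k S g"
  shows "Ck_on k S (\<lambda>x. f x * g x)"
  using assms(2,3)
proof (induction k arbitrary: f g)
  case 0
  then show ?case by (simp add: continuous_on_mult)
next
  case (Suc k)
  note f = Ck_on_SucD[OF Suc.prems(1)] and g = Ck_on_SucD[OF Suc.prems(2)]
  note f0 = Ck_on_Suc_imp[OF Suc.prems(1)] and g0 = Ck_on_Suc_imp[OF Suc.prems(2)]
  show ?case
    by (rule Ck_on_SucI[OF assms(1) has_derivative_mult[OF f(1) g(1)]
          Ck_on_add[OF assms(1) Suc.IH[OF f0 g(2)] Suc.IH[OF f(2) g0]]])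
qed

lemma Ck_on_inverse:
  fixes f :: "'a::real_normed_vector \<Rightarrow> 'b::real_normed_field"
  assumes "open S" "\<And>x. x \<in> S \<Longrightarrow> f x \<noteq> 0" "Ck_on k S f"
  shows "Ck_on k S (\<lambda>x. inverse (f x))"
  using assms(3)
proof (induction k)
  case 0
  then show ?case using assms(2) by (auto intro: continuous_on_inverse)
next
  case (Suc k)
  note f = Ck_on_SucD[OF Suc.prems]
  have ih: "Ck_on k S (\<lambda>x. inverse (f x))" using Suc.IH Ck_on_Suc_imp[OF Suc.prems] by blast
  show ?case
    by (rule Ck_on_SucI[OF assms(1) Deriv.has_derivative_inverse[OF assms(2) f(1)]
          Ck_on_linear[OF assms(1) bounded_linear_minus[OF bounded_linear_ident]
            Ck_on_mult[OF assms(1) Ck_on_mult[OF assms(1) ih f(2)] ih]]])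
qed

lemma smooth_on_subset: "smooth_on S f \<Longrightarrow> T \<subseteq> S \<Longrightarrow> smooth_on T f"
  unfolding smooth_on_def using Ck_on_subset by blast

lemma smooth_on_const: "smooth_on S (\<lambda>x. c)"
  by (simp add: smooth_on_def Ck_on_const)

lemma smooth_on_add: "open S \<Longrightarrow> smooth_on S f \<Longrightarrow> smooth_on S g \<Longrightarrow> smooth_on S (\<lambda>x. f x + g x)"
  unfolding smooth_on_def using Ck_on_add by blast

lemma smooth_on_linear: "open S \<Longrightarrow> bounded_linear h \<Longrightarrow> smooth_on S f \<Longrightarrow> smooth_on S (\<lambda>x. h (f x))"
  unfolding smooth_on_def using Ck_on_linear by blast

lemma smooth_on_mult:
  fixes f g :: "'a::real_normed_vector \<Rightarrow> 'b::real_normed_algebra"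
  shows "open S \<Longrightarrow> smooth_on S f \<Longrightarrow> smooth_on S g \<Longrightarrow> smooth_on S (\<lambda>x. f x * g x)"
  unfolding smooth_on_def using Ck_on_mult by blast

lemma smooth_on_inverse:
  fixes f :: "'a::real_normed_vector \<Rightarrow> 'b::real_normed_field"
  shows "open S \<Longrightarrow> (\<And>x. x \<in> S \<Longrightarrow> f x \<noteq> 0) \<Longrightarrow> smooth_on S f \<Longrightarrow> smooth_on S (\<lambda>x. inverse (f x))"
  unfolding smooth_on_def using Ck_on_inverse by blast

lemma smooth_on_sum:
  assumes "open S" "\<And>i. i \<in> I \<Longrightarrow> smooth_on S (f i)"
  shows "smooth_on S (\<lambda>x. \<Sum>i\<in>I. f i x)"
  using assms(2)
  by (induction I rule: infinite_finite_induct) (auto intro: smooth_on_const smooth_on_add assms(1))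

lemma smooth_on_differentiable: "smooth_on S f \<Longrightarrow> x \<in> S \<Longrightarrow> f differentiable (at x)"
  unfolding smooth_on_def using Ck_on.simps(2) by blast

lemma smooth_on_frechet: "smooth_on S f \<Longrightarrow> smooth_on S (\<lambda>x. frechet_derivative f (at x) v)"
  unfolding smooth_on_def using Ck_on.simps(2) by blast

lemma smooth_on_continuous: "smooth_on S f \<Longrightarrow> continuous_on S f"
  unfolding smooth_on_def using Ck_on.simps(1) by blast

section \<open>Symmetry of second derivatives\<close>

text \<open>The second difference of \<open>f\<close> over a small parallelogram is symmetric in \<open>u\<close> and \<open>v\<close>; two
  applications of the mean value theorem identify it with a mixed second derivative at a nearby
  point. Exchanging the roles of \<open>u\<close> and \<open>v\<close> gives the symmetry of second derivatives.\<close>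

lemma second_difference_mean_value:
  fixes f :: "'a::real_normed_vector \<Rightarrow> real"
  assumes s: "s > 0"
    and sub: "\<And>a b. a \<in> {0..s} \<Longrightarrow> b \<in> {0..s} \<Longrightarrow> x + a *\<^sub>R u + b *\<^sub>R v \<in> S"
    and f: "\<And>y. y \<in> S \<Longrightarrow> (f has_derivative Df y) (at y)"
    and fu: "\<And>y. y \<in> S \<Longrightarrow> ((\<lambda>y. Df y u) has_derivative Du y) (at y)"
  obtains a b where "a \<in> {0..s}" "b \<in> {0..s}"
    "f (x + s *\<^sub>R u + s *\<^sub>R v) - f (x + s *\<^sub>R u) - f (x + s *\<^sub>R v) + f x
      = s * s * Du (x + a *\<^sub>R u + b *\<^sub>R v) v"
proof -
  define \<phi> where "\<phi> a = f (x + a *\<^sub>R u + s *\<^sub>R v) - f (x + a *\<^sub>R u)" for a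
  have scale: "L (c *\<^sub>R w) = c * L w" if "(g has_derivative L) (at y)" for L c w y and g :: "'a \<Rightarrow> real"
    using has_derivative_bounded_linear[OF that] linear_scale bounded_linear.linear by fastforce
  have "(\<phi> has_derivative (\<lambda>c. c * (Df (x + a *\<^sub>R u + s *\<^sub>R v) u - Df (x + a *\<^sub>R u) u))) (at a within {0..s})"
    if "a \<in> {0..s}" for a
  proof -
    have m: "x + a *\<^sub>R u + s *\<^sub>R v \<in> S" "x + a *\<^sub>R u \<in> S"
      using sub[OF that, of s] sub[OF that, of 0] s by auto
    have "((\<lambda>a. f (x + a *\<^sub>R u + s *\<^sub>R v)) has_derivative (\<lambda>c. Df (x + a *\<^sub>R u + s *\<^sub>R v) (c *\<^sub>R u))) (at a within {0..s})"
      by (rule has_derivative_compose[where g=f and f="\<lambda>a. x + a *\<^sub>R u + s *\<^sub>R v", OF _ f[OF m(1)]]) (auto intro!: derivative_eq_intros)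
    moreover have "((\<lambda>a. f (x + a *\<^sub>R u)) has_derivative (\<lambda>c. Df (x + a *\<^sub>R u) (c *\<^sub>R u))) (at a within {0..s})"
      by (rule has_derivative_compose[where g=f and f="\<lambda>a. x + a *\<^sub>R u", OF _ f[OF m(2)]]) (auto intro!: derivative_eq_intros)
    ultimately have "(\<phi> has_derivative (\<lambda>c. Df (x + a *\<^sub>R u + s *\<^sub>R v) (c *\<^sub>R u) - Df (x + a *\<^sub>R u) (c *\<^sub>R u))) (at a within {0..s})"
      unfolding \<phi>_def by (rule has_derivative_diff)
    then show ?thesis
      by (simp add: scale[OF f[OF m(1)]] scale[OF f[OF m(2)]] right_diff_distrib)
  qed
  from mvt_very_simple[of 0 s \<phi>, OF _ this] s obtain a where
    a: "a \<in> {0..s}" "\<phi> s - \<phi> 0 = s * (Df (x + a *\<^sub>R u + s *\<^sub>R v) u - Df (x + a *\<^sub>R u) u)"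
    by auto
  have "((\<lambda>b. Df (x + a *\<^sub>R u + b *\<^sub>R v) u) has_derivative (\<lambda>c. c * Du (x + a *\<^sub>R u + b *\<^sub>R v) v)) (at b within {0..s})"
    if "b \<in> {0..s}" for b
  proof -
    have m: "x + a *\<^sub>R u + b *\<^sub>R v \<in> S" using sub[OF a(1) that] .
    have "((\<lambda>b. Df (x + a *\<^sub>R u + b *\<^sub>R v) u) has_derivative (\<lambda>c. Du (x + a *\<^sub>R u + b *\<^sub>R v) (c *\<^sub>R v))) (at b within {0..s})"
      by (rule has_derivative_compose[where g="\<lambda>y. Df y u" and f="\<lambda>b. x + a *\<^sub>R u + b *\<^sub>R v", OF _ fu[OF m]]) (auto intro!: derivative_eq_intros)
    then show ?thesis by (simp add: scale[OF fu[OF m]])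
  qed
  from mvt_very_simple[of 0 s, OF _ this] s obtain b where
    b: "b \<in> {0..s}" "Df (x + a *\<^sub>R u + s *\<^sub>R v) u - Df (x + a *\<^sub>R u) u = s * Du (x + a *\<^sub>R u + b *\<^sub>R v) v"
    by auto
  show ?thesis
    by (rule that[OF a(1) b(1)]) (use a(2) b(2) in \<open>simp add: \<phi>_def algebra_simps\<close>)
qed

lemma second_derivative_symmetric_real:
  fixes f :: "'a::real_normed_vector \<Rightarrow> real"
  assumes S: "open S" "x \<in> S"
    and f: "\<And>y. y \<in> S \<Longrightarrow> (f has_derivative Df y) (at y)"
    and fu: "\<And>y. y \<in> S \<Longrightarrow> ((\<lambda>y. Df y u) has_derivative Du y) (at y)"
    and fv: "\<And>y. y \<in> S \<Longrightarrow> ((\<lambda>y. Df y v) has_derivative Dv y) (at y)"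
    and cont: "continuous_on S (\<lambda>y. Du y v)" "continuous_on S (\<lambda>y. Dv y u)"
  shows "Du x v = Dv x u"
proof (rule ccontr)
  assume ne: "Du x v \<noteq> Dv x u"
  define e where "e = \<bar>Du x v - Dv x u\<bar> / 2"
  have e: "e > 0" using ne by (simp add: e_def)
  have "isCont (\<lambda>y. Du y v) x" "isCont (\<lambda>y. Dv y u) x"
    using cont S by (auto simp: continuous_on_eq_continuous_at)
  then obtain d1 d2 where d: "d1 > 0" "\<And>y. dist y x < d1 \<Longrightarrow> dist (Du y v) (Du x v) < e"
    "d2 > 0" "\<And>y. dist y x < d2 \<Longrightarrow> dist (Dv y u) (Dv x u) < e"
    using e unfolding continuous_at_eps_delta by metis
  obtain d3 where d3: "d3 > 0" "ball x d3 \<subseteq> S" using S open_contains_ball by blast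
  define d where "d = min d1 (min d2 d3)"
  have "d > 0" using d d3 by (simp add: d_def)
  define c where "c = norm u + norm v + 1"
  define s where "s = d / (2 * c)"
  have k: "c > 0"
    unfolding c_def
    using norm_ge_zero[of u] norm_ge_zero[of v] by linarith
  have s: "s > 0" using \<open>d > 0\<close> k by (auto simp: s_def intro!: divide_pos_pos)
  have near: "dist (x + a *\<^sub>R u + b *\<^sub>R v) x < d" if "a \<in> {0..s}" "b \<in> {0..s}" for a b
  proof -
    have "dist (x + a *\<^sub>R u + b *\<^sub>R v) x = norm (a *\<^sub>R u + b *\<^sub>R v)" by (simp add: dist_norm)
    also have "\<dots> \<le> a * norm u + b * norm v"
      using norm_triangle_ineq[of "a *\<^sub>R u" "b *\<^sub>R v"] that by simp
    also have "\<dots> \<le> s * norm u + s * norm v"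
      using that by (intro add_mono mult_right_mono) auto
    also have "\<dots> \<le> s * (norm u + norm v + 1)" using s by (simp add: algebra_simps)
    also have "\<dots> = d / 2" using s_def nonzero_mult_div_cancel_right[of c] k by (simp add: c_def[symmetric])
    finally show ?thesis using \<open>d > 0\<close> by linarith
  qed
  have sub: "x + a *\<^sub>R u + b *\<^sub>R v \<in> S" if "a \<in> {0..s}" "b \<in> {0..s}" for a b
    using near[OF that] d3 by (force simp: d_def dist_commute)
  have sub': "x + a *\<^sub>R v + b *\<^sub>R u \<in> S" if "a \<in> {0..s}" "b \<in> {0..s}" for a b
    using sub[OF that(2,1)] by (simp add: algebra_simps)
  obtain a b where ab: "a \<in> {0..s}" "b \<in> {0..s}"
    "f (x + s *\<^sub>R u + s *\<^sub>R v) - f (x + s *\<^sub>R u) - f (x + s *\<^sub>R v) + f x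
      = s * s * Du (x + a *\<^sub>R u + b *\<^sub>R v) v"
    using second_difference_mean_value[OF s sub f fu] by metis
  obtain a' b' where ab': "a' \<in> {0..s}" "b' \<in> {0..s}"
    "f (x + s *\<^sub>R v + s *\<^sub>R u) - f (x + s *\<^sub>R v) - f (x + s *\<^sub>R u) + f x
      = s * s * Dv (x + a' *\<^sub>R v + b' *\<^sub>R u) u"
    using second_difference_mean_value[OF s sub' f fv] by metis
  have "s * s * Du (x + a *\<^sub>R u + b *\<^sub>R v) v = s * s * Dv (x + b' *\<^sub>R u + a' *\<^sub>R v) u"
    using ab(3) ab'(3) by (simp add: algebra_simps)
  then have "Du (x + a *\<^sub>R u + b *\<^sub>R v) v = Dv (x + b' *\<^sub>R u + a' *\<^sub>R v) u" using s by simp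
  moreover have "dist (Du (x + a *\<^sub>R u + b *\<^sub>R v) v) (Du x v) < e"
    using near[OF ab(1,2)] d(2) by (simp add: d_def)
  moreover have "dist (Dv (x + b' *\<^sub>R u + a' *\<^sub>R v) u) (Dv x u) < e"
    using near[OF ab'(2,1)] d(4) by (simp add: d_def)
  ultimately show False
    using dist_triangle3[of "Du x v" "Dv x u" "Du (x + a *\<^sub>R u + b *\<^sub>R v) v"]
    by (simp add: e_def dist_real_def)
qed

text \<open>Real and imaginary part are treated separately, since the mean value theorem with a point of
  evaluation needs real values.\<close>

lemma second_derivative_symmetric:
  fixes f :: "'a::real_normed_vector \<Rightarrow> complex"
  assumes S: "open S" "x \<in> S" and f: "smooth_on S f"
  shows "frechet_derivative (\<lambda>y. frechet_derivative f (at y) u) (at x) v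
       = frechet_derivative (\<lambda>y. frechet_derivative f (at y) v) (at x) u"
proof -
  have der: "(g has_derivative frechet_derivative g (at y)) (at y)" if "smooth_on S g" "y \<in> S" for y and g :: "'a \<Rightarrow> complex"
    using smooth_on_differentiable[OF that] frechet_derivative_works by blast
  define d where "d g v y = frechet_derivative g (at y) v" for g :: "'a \<Rightarrow> complex" and v y
  have d: "smooth_on S (d g v)" if "smooth_on S g" for g v
    unfolding d_def by (rule smooth_on_frechet[OF that])
  have *: "h (d (d f u) v x) = h (d (d f v) u x)"
    if h: "bounded_linear h" for h :: "complex \<Rightarrow> real"
  proof -
    have 1: "((\<lambda>y. h (f y)) has_derivative (\<lambda>v. h (d f v y))) (at y)" if "y \<in> S" for y
      unfolding d_def by (rule bounded_linear.has_derivative[OF h der[OF f that]])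
    have 2: "((\<lambda>y. h (d f w y)) has_derivative (\<lambda>v. h (d (d f w) v y))) (at y)" if "y \<in> S" for y w
      unfolding d_def by (rule bounded_linear.has_derivative[OF h der[OF d[OF f, unfolded d_def] that]])
    have 3: "continuous_on S (\<lambda>y. h (d (d f w) w' y))" for w w'
      by (rule bounded_linear.continuous_on[OF h smooth_on_continuous[OF d[OF d[OF f]]]])
    show ?thesis by (rule second_derivative_symmetric_real[OF S 1 2 2 3 3])
  qed
  have "d (d f u) v x = d (d f v) u x"
    using *[OF bounded_linear_Re] *[OF bounded_linear_Im] by (rule complex_eqI)
  then show ?thesis by (simp add: d_def[abs_def])
qed

section \<open>Derivatives along a hypersurface\<close>

text \<open>A tangent vector \<open>v\<close> is a limit of rescaled chords of the hypersurface: for small \<open>t\<close> the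
  function \<open>\<rho>\<close> changes sign on the transversal segment \<open>p + t(v + s n)\<close>, \<open>|s| \<le> e\<close>, because
  its linear part there is \<open>t s\<close> and the error is small compared with \<open>t e\<close>. So the segment meets the
  hypersurface, and the difference of the two derivatives is small at \<open>v + s n\<close>.\<close>

lemma has_derivative_within_hypersurface_unique:
  fixes f :: "'a::real_normed_vector \<Rightarrow> 'b::real_normed_vector" and \<rho> :: "'a \<Rightarrow> real"
  assumes U: "open U" "p \<in> U" "\<rho> p = 0" and cont: "continuous_on U \<rho>"
    and \<rho>: "(\<rho> has_derivative D\<rho>) (at p)" and w: "D\<rho> w \<noteq> 0" and v: "D\<rho> v = 0"
    and D: "(f has_derivative D) (at p within {z\<in>U. \<rho> z = 0})"
    and D': "(f has_derivative D') (at p within {z\<in>U. \<rho> z = 0})"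
  shows "D v = D' v"
proof (rule ccontr)
  assume ne: "D v \<noteq> D' v"
  define M where "M = {z\<in>U. \<rho> z = 0}"
  define E where "E x = D x - D' x" for x
  have E: "((\<lambda>x. 0::'b) has_derivative E) (at p within M)"
    using has_derivative_diff[OF D D'] by (simp add: E_def[abs_def] M_def)
  have linE: "linear E" using has_derivative_bounded_linear[OF E] bounded_linear.linear by blast
  have lin\<rho>: "linear D\<rho>" using has_derivative_bounded_linear[OF \<rho>] bounded_linear.linear by blast
  \<comment> \<open>normalise the transversal direction\<close>
  define n where "n = (1 / D\<rho> w) *\<^sub>R w"
  have n: "D\<rho> n = 1" using w by (simp add: n_def linear_scale[OF lin\<rho>])
  \<comment> \<open>a bound for \<open>v + s n\<close> when \<open>|s| \<le> 1\<close>\<close>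
  define K where "K = norm v + norm n + 1"
  have K: "K > 0" unfolding K_def by (intro add_nonneg_pos add_nonneg_nonneg) auto
  \<comment> \<open>so small that an error \<open>e K\<close> at \<open>v + s n\<close> still forces \<open>E v = 0\<close>\<close>
  define e where "e = min 1 (norm (E v) / (2 * (norm (E n) + K)))"
  have "norm (E v) > 0" using ne by (simp add: E_def)
  moreover have EK: "norm (E n) + K > 0" using K norm_ge_zero[of "E n"] by linarith
  ultimately have e: "e > 0" "e \<le> 1" by (auto simp: e_def)
  have e_small: "e * (norm (E n) + K) < norm (E v)"
  proof -
    have "e * (norm (E n) + K) \<le> (norm (E v) / (2 * (norm (E n) + K))) * (norm (E n) + K)"
      using EK by (intro mult_right_mono) (auto simp: e_def)
    also have "\<dots> = norm (E v) / 2" using EK by (simp add: field_simps)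
    finally show ?thesis using \<open>norm (E v) > 0\<close> by linarith
  qed
  obtain d1 where d1: "d1 > 0" "\<And>y. y \<in> M \<Longrightarrow> norm (y - p) < d1 \<Longrightarrow> norm (E (y - p)) \<le> e * norm (y - p)"
  proof -
    have "\<exists>d>0. \<forall>y\<in>M. norm (y - p) < d \<longrightarrow> norm (E (y - p)) \<le> e * norm (y - p)"
      using E e(1) unfolding has_derivative_within_alt by simp
    then show ?thesis using that by blast
  qed
  have "e / (2 * K) > 0" using e K by simp
  then obtain d2 where d2: "d2 > 0" "\<And>y. norm (y - p) < d2 \<Longrightarrow> norm (\<rho> y - \<rho> p - D\<rho> (y - p)) \<le> e / (2 * K) * norm (y - p)"
    using \<rho> unfolding has_derivative_at_alt by blast
  obtain d3 where d3: "d3 > 0" "ball p d3 \<subseteq> U" using U open_contains_ball by blast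
  define t where "t = min d1 (min d2 d3) / (2 * K)"
  have t: "t > 0" using d1 d2 d3 K by (simp add: t_def)
  have tK: "t * K < d1" "t * K < d2" "t * K < d3"
    using d1(1) d2(1) d3(1) K by (auto simp: t_def min_def field_simps)
  define y where "y s = p + t *\<^sub>R (v + s *\<^sub>R n)" for s
  have nvs: "norm (v + s *\<^sub>R n) \<le> K" if "\<bar>s\<bar> \<le> e" for s
  proof -
    have "norm (v + s *\<^sub>R n) \<le> norm v + \<bar>s\<bar> * norm n" using norm_triangle_ineq[of v "s *\<^sub>R n"] by simp
    also have "\<dots> \<le> norm v + 1 * norm n" using that e by (intro add_left_mono mult_right_mono) auto
    finally show ?thesis by (simp add: K_def)
  qed
  have nys: "norm (y s - p) \<le> t * K" if "\<bar>s\<bar> \<le> e" for s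
    using nvs[OF that] t by (simp add: y_def)
  have yU: "y s \<in> U" if "\<bar>s\<bar> \<le> e" for s
    using nys[OF that] tK(3) d3(2) by (auto simp: dist_norm norm_minus_commute subset_iff)
  have \<rho>y: "\<bar>\<rho> (y s) - t * s\<bar> \<le> t * e / 2" if "\<bar>s\<bar> \<le> e" for s
  proof -
    have "D\<rho> (y s - p) = t * s"
      by (simp add: y_def linear_scale[OF lin\<rho>] linear_add[OF lin\<rho>] v n)
    moreover have "norm (\<rho> (y s) - \<rho> p - D\<rho> (y s - p)) \<le> e / (2 * K) * norm (y s - p)"
      using d2(2) nys[OF that] tK(2) by fastforce
    moreover have "e / (2 * K) * norm (y s - p) \<le> e / (2 * K) * (t * K)"
      using nys[OF that] e K by (intro mult_left_mono) auto
    moreover have "e / (2 * K) * (t * K) = t * e / 2" using K by simp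
    ultimately show ?thesis using U(3) by simp
  qed
  have "t * e > 0" "\<bar>-e\<bar> \<le> e" "\<bar>e\<bar> \<le> e" using e t by auto
  then have "\<rho> (y (-e)) \<le> 0" "0 \<le> \<rho> (y e)"
    using \<rho>y[of "-e"] \<rho>y[of e] unfolding abs_le_iff mult_minus_right by linarith+
  moreover have "continuous_on {-e..e} (\<lambda>s. \<rho> (y s))"
    by (rule continuous_on_compose2[OF cont]) (auto simp: y_def intro!: continuous_intros yU[unfolded y_def])
  ultimately obtain s where s: "-e \<le> s" "s \<le> e" "\<rho> (y s) = 0"
    using IVT'[of "\<lambda>s. \<rho> (y s)" "-e" 0 e] e by auto
  then have sabs: "\<bar>s\<bar> \<le> e" by simp
  have "y s \<in> M" using s yU[OF sabs] by (simp add: M_def)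
  then have "norm (E (y s - p)) \<le> e * norm (y s - p)"
    using d1(2) nys[OF sabs] tK(1) by fastforce
  then have "norm (E (v + s *\<^sub>R n)) \<le> e * norm (v + s *\<^sub>R n)"
    using t by (simp add: y_def linear_scale[OF linE])
  also have "\<dots> \<le> e * K" using nvs[OF sabs] e by (intro mult_left_mono) auto
  finally have 1: "norm (E v + s *\<^sub>R E n) \<le> e * K"
    by (simp add: linear_add[OF linE] linear_scale[OF linE])
  have "norm (E v) \<le> norm (E v + s *\<^sub>R E n) + norm (s *\<^sub>R E n)"
    using norm_triangle_ineq4[of "E v + s *\<^sub>R E n" "s *\<^sub>R E n"] by simp
  also have "\<dots> \<le> e * K + e * norm (E n)"
    using 1 sabs by (intro add_mono) (auto intro: mult_right_mono)
  finally show False using e_small by (simp add: algebra_simps)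
qed

section \<open>Wirtinger derivatives\<close>

text \<open>Indexing the frame of the complexified tangent space by \<open>Inl j\<close> (for \<open>\<partial>/\<partial>z\<^sub>j\<close>) and
  \<open>Inr j\<close> (for its conjugate), as in the type of complex vectors, lets a vector act as one sum over
  all indices.\<close>

definition wirt :: "'m + 'm \<Rightarrow> (complex^'m::finite \<Rightarrow> complex) \<Rightarrow> complex^'m \<Rightarrow> complex" where
  "wirt i F p = (case i of Inl j \<Rightarrow> dz j F p | Inr j \<Rightarrow> dzbar j F p)"

lemma wirt_simps [simp]: "wirt (Inl j) = dz j" "wirt (Inr j) = dzbar j"
  by (auto simp: wirt_def fun_eq_iff)

lemma sum_Inl_Inr:
  fixes g :: "'m::finite + 'm \<Rightarrow> 'b::comm_monoid_add"
  shows "(\<Sum>i\<in>UNIV. g i) = (\<Sum>j\<in>UNIV. g (Inl j)) + (\<Sum>j\<in>UNIV. g (Inr j))"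
  using sum.Plus[of "UNIV::'m set" "UNIV::'m set" g] by (simp add: comp_def)

lemma vconj_nth [simp]: "vconj v $ Inl j = cnj (v $ Inr j)" "vconj v $ Inr j = cnj (v $ Inl j)"
  by (simp_all add: vconj_def)

lemma vconj_vconj [simp]: "vconj (vconj v) = v"
  by (auto simp: vec_eq_iff vconj_def split: sum.splits)

lemma fconj_fconj [simp]: "fconj (fconj X) = X"
  by (simp add: fconj_def)

lemma fconj_nth: "fconj X q $ Inl j = cnj (X q $ Inr j)" "fconj X q $ Inr j = cnj (X q $ Inl j)"
  by (simp_all add: fconj_def)

lemma vec_eq_sum_axis: "v = (\<Sum>j\<in>UNIV. axis j (v $ j))" for v :: "'a::comm_monoid_add ^ 'm::finite"
  by (simp add: vec_eq_iff axis_def)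

lemma real_linear_axis_expand:
  fixes D :: "complex^'m::finite \<Rightarrow> complex"
  assumes "linear D"
  shows "D u = (\<Sum>j\<in>UNIV. of_real (Re (u $ j)) * D (axis j 1) + of_real (Im (u $ j)) * D (axis j \<i>))"
proof -
  have ax: "axis j c = Re c *\<^sub>R axis j 1 + Im c *\<^sub>R axis j \<i>" for j :: 'm and c
    by (auto simp: vec_eq_iff axis_def complex_eq_iff)
  have A: "D (axis j c) = of_real (Re c) * D (axis j 1) + of_real (Im c) * D (axis j \<i>)" for j c
    by (subst ax) (simp only: linear_add[OF assms] linear_scale[OF assms] scaleR_conv_of_real[where 'a=complex])
  have B: "D u = (\<Sum>j\<in>UNIV. D (axis j (u $ j)))"
    by (subst vec_eq_sum_axis) (rule linear_sum[OF assms])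
  show ?thesis by (subst B) (intro sum.cong refl A)
qed

text \<open>The right-hand side is the complex linear extension of the derivative to the vector
  \<open>v = re_vec v + \<i> im_vec v\<close>, which is how \<open>act\<close> evaluates a derivative.\<close>

lemma wirt_eq_frechet:
  assumes "F differentiable (at p)"
  shows "(\<Sum>i\<in>UNIV. v $ i * wirt i F p)
       = frechet_derivative F (at p) (re_vec v) + \<i> * frechet_derivative F (at p) (im_vec v)"
proof -
  let ?D = "frechet_derivative F (at p)"
  have lin: "linear ?D"
    using assms by (metis frechet_derivative_works has_derivative_linear)
  have "a * ((x - \<i> * y) / 2) + b * ((x + \<i> * y) / 2)
      = of_real (Re ((a + cnj b) / 2)) * x + of_real (Im ((a + cnj b) / 2)) * y
        + \<i> * (of_real (Re ((a - cnj b) / (2 * \<i>))) * x + of_real (Im ((a - cnj b) / (2 * \<i>))) * y)"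
    for a b x y
    by (simp add: complex_eq_iff Re_divide Im_divide field_simps)
  then have "v $ Inl j * dz j F p + v $ Inr j * dzbar j F p
      = of_real (Re (re_vec v $ j)) * ?D (axis j 1) + of_real (Im (re_vec v $ j)) * ?D (axis j \<i>)
        + \<i> * (of_real (Re (im_vec v $ j)) * ?D (axis j 1) + of_real (Im (im_vec v $ j)) * ?D (axis j \<i>))" for j
    by (simp add: dz_def dzbar_def re_vec_def im_vec_def)
  then show ?thesis
    by (simp add: sum_Inl_Inr sum.distrib[symmetric] sum_distrib_left
        real_linear_axis_expand[OF lin, of "re_vec v"] real_linear_axis_expand[OF lin, of "im_vec v"])
qed

text \<open>Both kinds of Wirtinger derivative are complex combinations of two directional derivatives; in
  this form the rules below need no case distinction.\<close>

lemma wirt_eq_directional: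
  "\<exists>u u' c. \<forall>F p. wirt i F p = (frechet_derivative F (at p) u + c * frechet_derivative F (at p) u') / 2"
proof (cases i)
  case (Inl j)
  show ?thesis by (rule exI[of _ "axis j 1"], rule exI[of _ "axis j \<i>"], rule exI[of _ "-\<i>"]) (simp add: Inl dz_def)
next
  case (Inr j)
  show ?thesis by (rule exI[of _ "axis j 1"], rule exI[of _ "axis j \<i>"], rule exI[of _ "\<i>"]) (simp add: Inr dzbar_def)
qed

lemma has_derivative_frechet:
  "f differentiable (at p) \<Longrightarrow> (f has_derivative frechet_derivative f (at p)) (at p)"
  using frechet_derivative_works by blast

lemma wirt_const: "wirt i (\<lambda>q. c) p = 0"
  by (cases i) (simp_all add: dz_def dzbar_def)

lemma wirt_add:
  assumes "F differentiable (at p)" "G differentiable (at p)"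
  shows "wirt i (\<lambda>q. F q + G q) p = wirt i F p + wirt i G p"
proof -
  obtain u u' c where w: "\<forall>F p. wirt i F p = (frechet_derivative F (at p) u + c * frechet_derivative F (at p) u') / 2"
    using wirt_eq_directional[of i] by (elim exE)
  note d = frechet_derivative_at[OF has_derivative_add[OF assms[THEN has_derivative_frechet]], symmetric]
  show ?thesis unfolding w[rule_format] d by (simp add: algebra_simps add_divide_distrib)
qed

lemma wirt_mult:
  assumes "F differentiable (at p)" "G differentiable (at p)"
  shows "wirt i (\<lambda>q. F q * G q) p = wirt i F p * G p + F p * wirt i G p"
proof -
  obtain u u' c where w: "\<forall>F p. wirt i F p = (frechet_derivative F (at p) u + c * frechet_derivative F (at p) u') / 2"
    using wirt_eq_directional[of i] by (elim exE)
  note d = frechet_derivative_at[OF has_derivative_mult[OF assms[THEN has_derivative_frechet]], symmetric]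
  show ?thesis unfolding w[rule_format] d by (simp add: algebra_simps add_divide_distrib)
qed

lemma wirt_sum:
  assumes "\<And>l. l \<in> I \<Longrightarrow> F l differentiable (at p)"
  shows "wirt i (\<lambda>q. \<Sum>l\<in>I. F l q) p = (\<Sum>l\<in>I. wirt i (F l) p)"
  using assms
  by (induction I rule: infinite_finite_induct) (auto simp: wirt_const wirt_add)

lemma wirt_cnj:
  assumes "F differentiable (at p)"
  shows "dz j (\<lambda>q. cnj (F q)) p = cnj (dzbar j F p)" "dzbar j (\<lambda>q. cnj (F q)) p = cnj (dz j F p)"
  unfolding dz_def dzbar_def
    frechet_derivative_at[OF bounded_linear.has_derivative[OF bounded_linear_cnj assms[THEN has_derivative_frechet]], symmetric]
  by simp_all

lemma smooth_on_wirt: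
  assumes "open S" "smooth_on S F"
  shows "smooth_on S (wirt i F)"
proof -
  obtain u u' c where w: "\<forall>F p. wirt i F p = (frechet_derivative F (at p) u + c * frechet_derivative F (at p) u') / 2"
    using wirt_eq_directional[of i] by (elim exE)
  have "smooth_on S (\<lambda>p. (frechet_derivative F (at p) u + c * frechet_derivative F (at p) u') / 2)"
    by (intro smooth_on_linear[OF assms(1) bounded_linear_divide] smooth_on_add smooth_on_mult
        smooth_on_const smooth_on_frechet assms)
  then show ?thesis by (simp add: w[rule_format, abs_def])
qed

lemma wirt_commute:
  assumes "open S" "p \<in> S" "smooth_on S F"
  shows "wirt i (wirt l F) p = wirt l (wirt i F) p"
proof -
  obtain u u' c where w: "\<forall>F p. wirt i F p = (frechet_derivative F (at p) u + c * frechet_derivative F (at p) u') / 2"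
    using wirt_eq_directional[of i] by (elim exE)
  obtain v v' d where w': "\<forall>F p. wirt l F p = (frechet_derivative F (at p) v + d * frechet_derivative F (at p) v') / 2"
    using wirt_eq_directional[of l] by (elim exE)
  define D where "D x q = frechet_derivative F (at q) x" for x q
  have D: "(D x has_derivative frechet_derivative (D x) (at p)) (at p)" for x
    unfolding D_def
    by (intro has_derivative_frechet smooth_on_differentiable[OF smooth_on_frechet[OF assms(3)] assms(2)])
  have d: "((\<lambda>q. (D a q + c * D b q) / 2) has_derivative
         (\<lambda>x. (frechet_derivative (D a) (at p) x + c * frechet_derivative (D b) (at p) x) / 2)) (at p)" for a b c
    by (intro bounded_linear.has_derivative[OF bounded_linear_divide] has_derivative_add
        bounded_linear.has_derivative[OF bounded_linear_mult_right] D)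
  have sym: "frechet_derivative (D x) (at p) y = frechet_derivative (D y) (at p) x" for x y
    unfolding D_def by (rule second_derivative_symmetric[OF assms])
  have "wirt l F = (\<lambda>q. (D v q + d * D v' q) / 2)" "wirt i F = (\<lambda>q. (D u q + c * D u' q) / 2)"
    by (auto simp: w w' D_def)
  then show ?thesis
    by (simp add: w w' frechet_derivative_at[OF d, symmetric] sym[of v u] sym[of v u'] sym[of v' u] sym[of v' u'])
       (simp add: field_simps)
qed

section \<open>Functions that are smooth along a set\<close>

lemma smooth_along_of_smooth_on: "open U \<Longrightarrow> M \<subseteq> U \<Longrightarrow> smooth_on U f \<Longrightarrow> smooth_along M f"
  unfolding smooth_along_def by blast

lemma smooth_along_cong: "smooth_along M f \<Longrightarrow> (\<And>q. q \<in> M \<Longrightarrow> f q = g q) \<Longrightarrow> smooth_along M g"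
  unfolding smooth_along_def by (metis IntD2)

lemma smooth_along_const: "smooth_along M (\<lambda>q. c)"
  unfolding smooth_along_def using smooth_on_const by blast

lemma smooth_along_linear:
  assumes "bounded_linear h" "smooth_along M f"
  shows "smooth_along M (\<lambda>q. h (f q))"
  using assms(2) smooth_on_linear[OF _ assms(1)] unfolding smooth_along_def by metis

text \<open>Local extensions of the two arguments have to be restricted to a common neighbourhood.\<close>

lemma smooth_along_binary:
  fixes f :: "'a::real_normed_vector \<Rightarrow> 'b::real_normed_vector" and g :: "'a \<Rightarrow> 'c::real_normed_vector"
    and h :: "'b \<Rightarrow> 'c \<Rightarrow> 'd::real_normed_vector"
  assumes "smooth_along M f" "smooth_along M g"
    and "\<And>(V :: 'a set) F G. open V \<Longrightarrow> smooth_on V F \<Longrightarrow> smooth_on V G \<Longrightarrow> smooth_on V (\<lambda>q. h (F q) (G q))"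
  shows "smooth_along M (\<lambda>q. h (f q) (g q))"
  unfolding smooth_along_def
proof
  fix p assume "p \<in> M"
  then obtain V F W G where V: "open V" "p \<in> V" "smooth_on V F" "\<forall>q\<in>V \<inter> M. F q = f q"
    "open W" "p \<in> W" "smooth_on W G" "\<forall>q\<in>W \<inter> M. G q = g q"
    using assms(1,2) unfolding smooth_along_def by metis
  have "smooth_on (V \<inter> W) (\<lambda>q. h (F q) (G q))"
    using V by (intro assms(3)) (auto intro: smooth_on_subset[OF V(3)] smooth_on_subset[OF V(7)])
  with V show "\<exists>V F. open V \<and> p \<in> V \<and> smooth_on V F \<and> (\<forall>q\<in>V \<inter> M. F q = h (f q) (g q))"
    by (intro exI[of _ "V \<inter> W"] exI[of _ "\<lambda>q. h (F q) (G q)"])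
       auto
qed

lemma smooth_along_add: "smooth_along M f \<Longrightarrow> smooth_along M g \<Longrightarrow> smooth_along M (\<lambda>q. f q + g q)"
  by (rule smooth_along_binary) (auto intro: smooth_on_add)

lemma smooth_along_mult:
  fixes f g :: "'a::real_normed_vector \<Rightarrow> 'b::real_normed_algebra"
  shows "smooth_along M f \<Longrightarrow> smooth_along M g \<Longrightarrow> smooth_along M (\<lambda>q. f q * g q)"
  by (rule smooth_along_binary) (auto intro: smooth_on_mult)

lemma smooth_along_minus: "smooth_along M f \<Longrightarrow> smooth_along M (\<lambda>q. - f q)"
  by (rule smooth_along_linear[OF bounded_linear_minus[OF bounded_linear_ident]])

lemma smooth_along_diff: "smooth_along M f \<Longrightarrow> smooth_along M g \<Longrightarrow> smooth_along M (\<lambda>q. f q - g q)"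
  using smooth_along_add[OF _ smooth_along_minus, of M f g] by simp

lemma smooth_along_cnj: "smooth_along M f \<Longrightarrow> smooth_along M (\<lambda>q. cnj (f q))"
  by (rule smooth_along_linear[OF bounded_linear_cnj])

lemma smooth_along_sum:
  "(\<And>i. i \<in> I \<Longrightarrow> smooth_along M (f i)) \<Longrightarrow> smooth_along M (\<lambda>x. \<Sum>i\<in>I. f i x)"
  by (induction I rule: infinite_finite_induct) (auto intro: smooth_along_const smooth_along_add)

lemma smooth_along_inverse:
  fixes f :: "'a::real_normed_vector \<Rightarrow> 'b::real_normed_field"
  assumes "smooth_along M f" "\<And>q. q \<in> M \<Longrightarrow> f q \<noteq> 0"
  shows "smooth_along M (\<lambda>q. inverse (f q))"
  unfolding smooth_along_def
proof
  fix p assume p: "p \<in> M"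
  then obtain V F where V: "open V" "p \<in> V" "smooth_on V F" "\<forall>q\<in>V \<inter> M. F q = f q"
    using assms unfolding smooth_along_def by metis
  let ?W = "V \<inter> F -` (- {0})"
  have "open ?W"
    by (rule continuous_open_preimage[OF smooth_on_continuous[OF V(3)] V(1)]) auto
  then show "\<exists>V F. open V \<and> p \<in> V \<and> smooth_on V F \<and> (\<forall>q\<in>V \<inter> M. F q = inverse (f q))"
    using V p assms(2)
    by (intro exI[of _ ?W] exI[of _ "\<lambda>q. inverse (F q)"])
       (auto intro!: smooth_on_inverse intro: smooth_on_subset)
qed

lemma smooth_along_nth: "smooth_along M X \<Longrightarrow> smooth_along M (\<lambda>q. X q $ i)"
  for X :: "'a::real_normed_vector \<Rightarrow> complex ^ 'k::finite"
  by (rule smooth_along_linear[OF bounded_linear_vec_nth])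

text \<open>Summing the components along the axes avoids intersecting the neighbourhoods of all the
  component extensions.\<close>

lemma smooth_along_vecI:
  fixes X :: "'a::real_normed_vector \<Rightarrow> complex ^ 'k::finite"
  assumes "\<And>i. smooth_along M (\<lambda>q. X q $ i)"
  shows "smooth_along M X"
proof -
  have lin: "bounded_linear (axis i :: complex \<Rightarrow> complex ^ 'k)" for i
    by (subst linear_conv_bounded_linear[symmetric])
       (auto intro!: linearI simp: vec_eq_iff axis_def)
  have "smooth_along M (\<lambda>q. \<Sum>i\<in>UNIV. axis i (X q $ i))"
    by (intro smooth_along_sum smooth_along_linear[OF lin] assms)
  then show ?thesis by (simp add: vec_eq_sum_axis[symmetric])
qed

section \<open>Vector fields along a real hypersurface\<close>

definition tangent_at :: "(complex^'m::finite \<Rightarrow> real) \<Rightarrow> complex^'m \<Rightarrow> 'm cvec \<Rightarrow> bool" where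
  "tangent_at \<rho> p v \<longleftrightarrow> (\<Sum>i\<in>UNIV. v $ i * wirt i (cpx \<rho>) p) = 0"

lemma vfield_iff: "vfield M \<rho> X \<longleftrightarrow> smooth_along M X \<and> (\<forall>p\<in>M. tangent_at \<rho> p (X p))"
  by (simp add: vfield_def tangent_at_def sum_Inl_Inr sum.distrib mult.commute)

locale real_hypersurface =
  fixes U M :: "(complex^'m::finite) set" and \<rho> :: "complex^'m \<Rightarrow> real"
  assumes open_U: "open U" and smooth_\<rho>: "smooth_on U \<rho>" and M_eq: "M = {z\<in>U. \<rho> z = 0}"
    and regular: "\<And>p. p \<in> M \<Longrightarrow> frechet_derivative \<rho> (at p) \<noteq> (\<lambda>v. 0)"
begin

lemma M_sub: "M \<subseteq> U"
  by (auto simp: M_eq)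

lemma smooth_on_cpx_\<rho>: "smooth_on U (cpx \<rho>)"
  by (rule smooth_on_linear[OF open_U bounded_linear_of_real smooth_\<rho>])

lemma smooth_along_wirt_\<rho>:
  "smooth_along M (dz j (cpx \<rho>))" "smooth_along M (dzbar j (cpx \<rho>))"
  using smooth_along_of_smooth_on[OF open_U M_sub smooth_on_wirt[OF open_U smooth_on_cpx_\<rho>]]
  by (metis wirt_simps)+

lemma differentiable_\<rho>: "p \<in> U \<Longrightarrow> \<rho> differentiable (at p)"
  by (rule smooth_on_differentiable[OF smooth_\<rho>])

lemma frechet_cpx_\<rho>: "p \<in> U \<Longrightarrow> frechet_derivative (cpx \<rho>) (at p) = (\<lambda>v. of_real (frechet_derivative \<rho> (at p) v))"
  by (intro frechet_derivative_at[symmetric] bounded_linear.has_derivative[OF bounded_linear_of_real]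
      has_derivative_frechet differentiable_\<rho>)

lemma dzbar_\<rho>: "p \<in> U \<Longrightarrow> dzbar j (cpx \<rho>) p = cnj (dz j (cpx \<rho>) p)"
  by (simp add: dz_def dzbar_def frechet_cpx_\<rho>)

text \<open>The two real values are the real and the imaginary part of the single complex tangency
  equation, since \<open>\<rho>\<close> is real.\<close>

lemma tangent_kernel:
  assumes "p \<in> U" "tangent_at \<rho> p v"
  shows "frechet_derivative \<rho> (at p) (re_vec v) = 0" "frechet_derivative \<rho> (at p) (im_vec v) = 0"
proof -
  have "of_real (frechet_derivative \<rho> (at p) (re_vec v)) + \<i> * of_real (frechet_derivative \<rho> (at p) (im_vec v)) = (0::complex)"
    using wirt_eq_frechet[OF smooth_on_differentiable[OF smooth_on_cpx_\<rho> assms(1)], of v] assms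
    by (simp add: tangent_at_def frechet_cpx_\<rho>)
  then show "frechet_derivative \<rho> (at p) (re_vec v) = 0" "frechet_derivative \<rho> (at p) (im_vec v) = 0"
    by (simp_all add: complex_eq_iff)
qed

text \<open>The derivative within \<open>M\<close> is a choice among many linear maps, but on the real tangent vectors
  \<open>re_vec (X p)\<close> and \<open>im_vec (X p)\<close> all of them agree with the derivative of an extension.\<close>

lemma act_eq:
  assumes p: "p \<in> M" and X: "vfield M \<rho> X" and V: "open V" "p \<in> V"
    and F: "F differentiable (at p)" "\<And>q. q \<in> V \<Longrightarrow> q \<in> M \<Longrightarrow> F q = f q"
  shows "act M X f p = (\<Sum>i\<in>UNIV. X p $ i * wirt i F p)"
proof -
  let ?D' = "frechet_derivative F (at p)" and ?D = "frechet_derivative f (at p within M)"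
  obtain e where e: "e > 0" "ball p e \<subseteq> V" using V open_contains_ball by blast
  have f: "(f has_derivative ?D') (at p within M)"
    by (rule has_derivative_transform_within[OF has_derivative_at_withinI[OF has_derivative_frechet[OF F(1)]] e(1) p])
       (use e F(2) in \<open>auto simp: subset_iff dist_commute\<close>)
  then have f': "(f has_derivative ?D) (at p within M)"
    using frechet_derivative_works differentiableI by blast
  have pU: "p \<in> U" "\<rho> p = 0" using p by (auto simp: M_eq)
  obtain w where w: "frechet_derivative \<rho> (at p) w \<noteq> 0" using regular[OF p] by auto
  have "?D v = ?D' v" if "frechet_derivative \<rho> (at p) v = 0" for v
    using has_derivative_within_hypersurface_unique[OF open_U pU smooth_on_continuous[OF smooth_\<rho>]
        has_derivative_frechet[OF differentiable_\<rho>[OF pU(1)]] w that, of f ?D ?D'] f f'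
    by (simp add: M_eq)
  then show ?thesis
    using tangent_kernel[OF pU(1), of "X p"] X p wirt_eq_frechet[OF F(1), of "X p"] by (simp add: act_def Let_def vfield_iff)
qed

lemma act_eq_smooth_on:
  assumes "p \<in> M" "vfield M \<rho> X" "smooth_on U F"
  shows "act M X F p = (\<Sum>i\<in>UNIV. X p $ i * wirt i F p)"
  using act_eq[OF assms(1,2) open_U, of F F] assms M_sub smooth_on_differentiable by blast

lemma act_cong:
  assumes "p \<in> M" "\<And>q. q \<in> M \<Longrightarrow> f q = g q"
  shows "act M X f p = act M X g p"
proof -
  have "(f has_derivative D) (at p within M) \<longleftrightarrow> (g has_derivative D) (at p within M)" for D
    using has_derivative_transform[OF assms(1), of f g D] has_derivative_transform[OF assms(1), of g f D]
      assms(2) by metis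
  then have "frechet_derivative f (at p within M) = frechet_derivative g (at p within M)"
    by (simp add: frechet_derivative_def)
  then show ?thesis by (simp add: act_def)
qed

text \<open>Linearity of \<open>X f\<close> in \<open>X\<close>: the same extension of \<open>f\<close> serves all fields \<open>X\<close>.\<close>

lemma act_representation:
  assumes "p \<in> M" "smooth_along M f"
  shows "\<exists>c. \<forall>X. vfield M \<rho> X \<longrightarrow> act M X f p = (\<Sum>i\<in>UNIV. X p $ i * c i)"
proof -
  obtain V F where "open V" "p \<in> V" "smooth_on V F" "\<forall>q\<in>V \<inter> M. F q = f q"
    using assms unfolding smooth_along_def by blast
  then show ?thesis
    by (intro exI[of _ "\<lambda>i. wirt i F p"] allI impI act_eq[OF assms(1), where V=V])
       (auto intro: smooth_on_differentiable)
qed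

lemma act_const: "p \<in> M \<Longrightarrow> vfield M \<rho> X \<Longrightarrow> act M X (\<lambda>q. c) p = 0"
  using act_eq_smooth_on[of p X "\<lambda>q. c"] by (simp add: smooth_on_const wirt_const)

lemma act_add:
  assumes p: "p \<in> M" and X: "vfield M \<rho> X" and "smooth_along M f" "smooth_along M g"
  shows "act M X (\<lambda>q. f q + g q) p = act M X f p + act M X g p"
proof -
  obtain V F W G where V: "open V" "p \<in> V" "smooth_on V F" "\<forall>q\<in>V \<inter> M. F q = f q"
    "open W" "p \<in> W" "smooth_on W G" "\<forall>q\<in>W \<inter> M. G q = g q"
    using p assms unfolding smooth_along_def by metis
  note F = smooth_on_differentiable[OF V(3,2)] and G = smooth_on_differentiable[OF V(7,6)]
  have "act M X f p = (\<Sum>i\<in>UNIV. X p $ i * wirt i F p)"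
    using V by (intro act_eq[OF p X V(1,2) F]) auto
  moreover have "act M X g p = (\<Sum>i\<in>UNIV. X p $ i * wirt i G p)"
    using V by (intro act_eq[OF p X V(5,6) G]) auto
  moreover have "act M X (\<lambda>q. f q + g q) p = (\<Sum>i\<in>UNIV. X p $ i * wirt i (\<lambda>q. F q + G q) p)"
    using V by (intro act_eq[where V="V \<inter> W", OF p X]) (auto intro: differentiable_add F G)
  ultimately show ?thesis
    by (simp add: wirt_add[OF F G] sum.distrib distrib_left)
qed

lemma act_mult:
  assumes p: "p \<in> M" and X: "vfield M \<rho> X" and "smooth_along M f" "smooth_along M g"
  shows "act M X (\<lambda>q. f q * g q) p = act M X f p * g p + f p * act M X g p"
proof -
  obtain V F W G where V: "open V" "p \<in> V" "smooth_on V F" "\<forall>q\<in>V \<inter> M. F q = f q"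
    "open W" "p \<in> W" "smooth_on W G" "\<forall>q\<in>W \<inter> M. G q = g q"
    using p assms unfolding smooth_along_def by metis
  note F = smooth_on_differentiable[OF V(3,2)] and G = smooth_on_differentiable[OF V(7,6)]
  have "act M X f p = (\<Sum>i\<in>UNIV. X p $ i * wirt i F p)"
    using V by (intro act_eq[OF p X V(1,2) F]) auto
  moreover have "act M X g p = (\<Sum>i\<in>UNIV. X p $ i * wirt i G p)"
    using V by (intro act_eq[OF p X V(5,6) G]) auto
  moreover have "act M X (\<lambda>q. f q * g q) p = (\<Sum>i\<in>UNIV. X p $ i * wirt i (\<lambda>q. F q * G q) p)"
    using V by (intro act_eq[where V="V \<inter> W", OF p X]) (auto intro: differentiable_mult F G)
  moreover have "F p = f p" "G p = g p" using V p by auto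
  ultimately show ?thesis
    by (simp add: wirt_mult[OF F G] sum.distrib distrib_left sum_distrib_left sum_distrib_right mult_ac)
qed

lemma act_minus:
  assumes "p \<in> M" "vfield M \<rho> X" "smooth_along M f"
  shows "act M X (\<lambda>q. - f q) p = - act M X f p"
  using act_mult[of p X "\<lambda>q. -1" f] act_const[of p X] assms by (simp add: smooth_along_const)

lemma act_diff:
  assumes "p \<in> M" "vfield M \<rho> X" "smooth_along M f" "smooth_along M g"
  shows "act M X (\<lambda>q. f q - g q) p = act M X f p - act M X g p"
  using act_add[of p X f "\<lambda>q. - g q"] act_minus[of p X g] assms by (simp add: smooth_along_minus)

lemma act_sum:
  assumes "p \<in> M" "vfield M \<rho> X" "\<And>i. i \<in> I \<Longrightarrow> smooth_along M (f i)"
  shows "act M X (\<lambda>q. \<Sum>i\<in>I. f i q) p = (\<Sum>i\<in>I. act M X (f i) p)"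
  using assms(3)
  by (induction I rule: infinite_finite_induct) (auto simp: act_const act_add assms smooth_along_sum)

lemma vfield_add: "vfield M \<rho> X \<Longrightarrow> vfield M \<rho> Y \<Longrightarrow> vfield M \<rho> (\<lambda>q. X q + Y q)"
  by (auto simp: vfield_iff tangent_at_def distrib_right sum.distrib intro: smooth_along_add)

lemma vfield_scale:
  assumes "smooth_along M f" "vfield M \<rho> X"
  shows "vfield M \<rho> (\<lambda>q. f q *s X q)"
proof -
  have "smooth_along M (\<lambda>q. (f q *s X q) $ i)" for i
    using assms by (auto simp: vfield_iff intro!: smooth_along_mult smooth_along_nth)
  then show ?thesis
    using assms(2) by (auto simp: vfield_iff tangent_at_def mult.assoc sum_distrib_left[symmetric] intro!: smooth_along_vecI)
qed

lemma vfield_cong: "vfield M \<rho> X \<Longrightarrow> (\<And>q. q \<in> M \<Longrightarrow> X q = Y q) \<Longrightarrow> vfield M \<rho> Y"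
  by (auto simp: vfield_iff intro: smooth_along_cong)

lemma act_field_add:
  assumes "p \<in> M" "vfield M \<rho> X" "vfield M \<rho> Y" "smooth_along M f"
  shows "act M (\<lambda>q. X q + Y q) f p = act M X f p + act M Y f p"
proof -
  obtain c where c: "\<forall>X. vfield M \<rho> X \<longrightarrow> act M X f p = (\<Sum>i\<in>UNIV. X p $ i * c i)"
    using act_representation[OF assms(1,4)] by blast
  show ?thesis using c[rule_format, OF vfield_add[OF assms(2,3)]] c assms by (simp add: distrib_right sum.distrib)
qed

lemma act_field_scale:
  assumes "p \<in> M" "vfield M \<rho> X" "smooth_along M f" "smooth_along M g"
  shows "act M (\<lambda>q. g q *s X q) f p = g p * act M X f p"
proof -
  obtain c where c: "\<forall>X. vfield M \<rho> X \<longrightarrow> act M X f p = (\<Sum>i\<in>UNIV. X p $ i * c i)"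
    using act_representation[OF assms(1,3)] by blast
  show ?thesis using c[rule_format, OF vfield_scale[OF assms(4,2)]] c assms by (simp add: sum_distrib_left mult.assoc)
qed

lemma act_field_cong:
  "X p = Y p \<Longrightarrow> act M X f p = act M Y f p"
  by (simp add: act_def)

lemma smooth_along_act:
  assumes "vfield M \<rho> X" "smooth_along M f"
  shows "smooth_along M (act M X f)"
  unfolding smooth_along_def
proof
  fix p assume p: "p \<in> M"
  obtain V F W Y where V: "open V" "p \<in> V" "smooth_on V F" "\<forall>q\<in>V \<inter> M. F q = f q"
    "open W" "p \<in> W" "smooth_on W Y" "\<forall>q\<in>W \<inter> M. Y q = X q"
    using p assms unfolding smooth_along_def vfield_iff by metis
  have "smooth_on (V \<inter> W) (\<lambda>q. \<Sum>i\<in>UNIV. Y q $ i * wirt i F q)"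
    using V by (intro smooth_on_sum smooth_on_mult smooth_on_linear[OF _ bounded_linear_vec_nth] smooth_on_wirt)
      (auto intro: smooth_on_subset[OF V(3)] smooth_on_subset[OF V(7)])
  moreover have "act M X f q = (\<Sum>i\<in>UNIV. Y q $ i * wirt i F q)" if "q \<in> V \<inter> W \<inter> M" for q
    using act_eq[of q X V F f] V that assms(1) smooth_on_differentiable[OF V(3)] by auto
  ultimately show "\<exists>V F. open V \<and> p \<in> V \<and> smooth_on V F \<and> (\<forall>q\<in>V \<inter> M. F q = act M X f q)"
    using V by (intro exI[of _ "V \<inter> W"] exI[of _ "\<lambda>q. \<Sum>i\<in>UNIV. Y q $ i * wirt i F q"]) auto
qed

lemma tangent_vconj:
  assumes "p \<in> U"
  shows "tangent_at \<rho> p (vconj v) \<longleftrightarrow> tangent_at \<rho> p v"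
proof -
  have "(\<Sum>i\<in>UNIV. vconj v $ i * wirt i (cpx \<rho>) p) = cnj (\<Sum>i\<in>UNIV. v $ i * wirt i (cpx \<rho>) p)"
    by (simp add: sum_Inl_Inr dzbar_\<rho>[OF assms])
  then show ?thesis by (simp only: tangent_at_def complex_cnj_zero_iff)
qed

lemma vfield_fconj:
  assumes "vfield M \<rho> X"
  shows "vfield M \<rho> (fconj X)"
proof -
  have "smooth_along M (\<lambda>q. fconj X q $ i)" for i
    using assms by (cases i) (auto simp: fconj_def vfield_iff intro!: smooth_along_cnj smooth_along_nth)
  then show ?thesis
    using assms M_sub by (auto simp: vfield_iff fconj_def tangent_vconj intro!: smooth_along_vecI)
qed

lemma act_fconj:
  assumes "p \<in> M" "vfield M \<rho> X" "smooth_along M f"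
  shows "act M (fconj X) (\<lambda>q. cnj (f q)) p = cnj (act M X f p)"
proof -
  obtain V F where V: "open V" "p \<in> V" "smooth_on V F" "\<forall>q\<in>V \<inter> M. F q = f q"
    using assms unfolding smooth_along_def by blast
  note F = smooth_on_differentiable[OF V(3,2)]
  have "act M X f p = (\<Sum>i\<in>UNIV. X p $ i * wirt i F p)"
    using V by (intro act_eq[OF assms(1,2) V(1,2) F]) auto
  moreover have "act M (fconj X) (\<lambda>q. cnj (f q)) p = (\<Sum>i\<in>UNIV. fconj X p $ i * wirt i (\<lambda>q. cnj (F q)) p)"
    using V assms M_sub
    by (intro act_eq[OF assms(1) vfield_fconj[OF assms(2)] V(1,2) smooth_on_differentiable[OF smooth_on_linear[OF V(1) bounded_linear_cnj V(3)] V(2)]])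
       auto
  ultimately show ?thesis
    by (simp add: sum_Inl_Inr wirt_cnj[OF F] fconj_def)
qed

text \<open>Second derivatives of the extension cancel by symmetry, and what remains are the derivatives of
  the coefficients, which form the bracket. Stated with an extension \<open>F\<close>, this does not presuppose
  that the bracket is tangent, and it is applied to \<open>\<rho>\<close> to prove just that.\<close>

lemma act_commutator_extension:
  assumes p: "p \<in> M" and X: "vfield M \<rho> X" and Y: "vfield M \<rho> Y"
    and F: "open V" "p \<in> V" "smooth_on V F" "\<forall>q\<in>V \<inter> M. F q = f q"
  shows "act M X (act M Y f) p - act M Y (act M X f) p = (\<Sum>i\<in>UNIV. bracket M X Y p $ i * wirt i F p)"
proof -
  obtain VX X' where X': "open VX" "p \<in> VX" "smooth_on VX X'" "\<forall>q\<in>VX \<inter> M. X' q = X q"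
    using p X unfolding smooth_along_def vfield_iff by metis
  obtain VY Y' where Y': "open VY" "p \<in> VY" "smooth_on VY Y'" "\<forall>q\<in>VY \<inter> M. Y' q = Y q"
    using p Y unfolding smooth_along_def vfield_iff by metis
  \<comment> \<open>one direction of the commutator, on extensions of all the data\<close>
  have half: "act M A (act M B f) p = (\<Sum>l\<in>UNIV. act M A (\<lambda>q. B q $ l) p * wirt l F p)
        + (\<Sum>i\<in>UNIV. \<Sum>l\<in>UNIV. A p $ i * B p $ l * wirt i (wirt l F) p)"
    if A: "vfield M \<rho> A" and B: "vfield M \<rho> B"
      and B': "open W" "p \<in> W" "smooth_on W B'" "\<forall>q\<in>W \<inter> M. B' q = B q" for A B B' W
  proof -
    have dF: "wirt l F differentiable (at p)" for l
      using smooth_on_differentiable[OF smooth_on_wirt[OF F(1,3)] F(2)] .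
    have dB: "(\<lambda>q. B' q $ l) differentiable (at p)" for l
      using smooth_on_differentiable[OF smooth_on_linear[OF B'(1) bounded_linear_vec_nth B'(3)] B'(2)] .
    have "act M A (act M B f) p = (\<Sum>i\<in>UNIV. A p $ i * wirt i (\<lambda>q. \<Sum>l\<in>UNIV. B' q $ l * wirt l F q) p)"
    proof (rule act_eq[where V="V \<inter> W", OF p A])
      show "open (V \<inter> W)" "p \<in> V \<inter> W" using F B' by auto
      show "(\<lambda>q. \<Sum>l\<in>UNIV. B' q $ l * wirt l F q) differentiable (at p)"
        by (intro differentiable_sum ballI differentiable_mult dF dB finite)
      show "(\<Sum>l\<in>UNIV. B' q $ l * wirt l F q) = act M B f q" if "q \<in> V \<inter> W" "q \<in> M" for q
        using act_eq[of q B V F f] F B' B that smooth_on_differentiable[OF F(3)] by auto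
    qed
    also have "\<dots> = (\<Sum>i\<in>UNIV. \<Sum>l\<in>UNIV. A p $ i * (wirt i (\<lambda>q. B' q $ l) p * wirt l F p + B' p $ l * wirt i (wirt l F) p))"
      by (simp add: wirt_sum[OF differentiable_mult[OF dB dF]] wirt_mult[OF dB dF] sum_distrib_left)
    also have "\<dots> = (\<Sum>l\<in>UNIV. (\<Sum>i\<in>UNIV. A p $ i * wirt i (\<lambda>q. B' q $ l) p) * wirt l F p)
        + (\<Sum>i\<in>UNIV. \<Sum>l\<in>UNIV. A p $ i * B' p $ l * wirt i (wirt l F) p)"
      by (simp add: distrib_left sum.distrib sum_distrib_right mult.assoc) (rule sum.swap)
    finally have *: "act M A (act M B f) p = (\<Sum>l\<in>UNIV. (\<Sum>i\<in>UNIV. A p $ i * wirt i (\<lambda>q. B' q $ l) p) * wirt l F p)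
        + (\<Sum>i\<in>UNIV. \<Sum>l\<in>UNIV. A p $ i * B' p $ l * wirt i (wirt l F) p)" .
    have "act M A (\<lambda>q. B q $ l) p = (\<Sum>i\<in>UNIV. A p $ i * wirt i (\<lambda>q. B' q $ l) p)" for l
      using B' by (intro act_eq[OF p A B'(1,2) dB]) auto
    moreover have "B' p = B p" using B' p by auto
    ultimately show ?thesis by (simp add: *)
  qed
  have sym: "(\<Sum>i\<in>UNIV. \<Sum>l\<in>UNIV. X p $ i * Y p $ l * wirt i (wirt l F) p)
      = (\<Sum>i\<in>UNIV. \<Sum>l\<in>UNIV. Y p $ i * X p $ l * wirt i (wirt l F) p)"
    by (subst sum.swap) (simp add: wirt_commute[OF F(1,2,3)] mult.commute)
  show ?thesis
    unfolding half[OF X Y Y'] half[OF Y X X'] sym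
    by (simp add: bracket_def sum_subtractf left_diff_distrib)
qed

lemma tangent_bracket:
  assumes "p \<in> M" "vfield M \<rho> X" "vfield M \<rho> Y"
  shows "tangent_at \<rho> p (bracket M X Y p)"
proof -
  have zero: "act M Z (cpx \<rho>) q = 0" if "q \<in> M" "vfield M \<rho> Z" for Z q
    using act_eq_smooth_on[OF that smooth_on_cpx_\<rho>] that by (auto simp: vfield_iff tangent_at_def)
  have "act M Z (act M W (cpx \<rho>)) p = 0" if "vfield M \<rho> Z" "vfield M \<rho> W" for Z W
    using act_cong[OF assms(1), of "act M W (cpx \<rho>)" "\<lambda>q. 0" Z] zero that assms act_const[OF assms(1), of Z]
    by auto
  then show ?thesis
    using act_commutator_extension[OF assms open_U _ smooth_on_cpx_\<rho>, of "cpx \<rho>"] assms M_sub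
    by (auto simp: tangent_at_def)
qed

lemma vfield_bracket:
  assumes "vfield M \<rho> X" "vfield M \<rho> Y"
  shows "vfield M \<rho> (bracket M X Y)"
proof -
  have "smooth_along M (\<lambda>q. bracket M X Y q $ i)" for i
    using assms by (auto simp: bracket_def vfield_iff intro!: smooth_along_diff smooth_along_act smooth_along_nth)
  then show ?thesis
    using assms tangent_bracket by (auto simp: vfield_iff intro!: smooth_along_vecI)
qed

lemma act_bracket:
  assumes "p \<in> M" "vfield M \<rho> X" "vfield M \<rho> Y" "smooth_along M f"
  shows "act M (bracket M X Y) f p = act M X (act M Y f) p - act M Y (act M X f) p"
proof -
  obtain V F where V: "open V" "p \<in> V" "smooth_on V F" "\<forall>q\<in>V \<inter> M. F q = f q"
    using assms unfolding smooth_along_def by blast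
  then show ?thesis
    using act_eq[OF assms(1) vfield_bracket[OF assms(2,3)] V(1,2) smooth_on_differentiable[OF V(3,2)], of f]
      act_commutator_extension[OF assms(1-3) V] by auto
qed

end

section \<open>Hypersurfaces whose defining function has flat complex Hessian\<close>

locale flat_hypersurface =
  fixes U M :: "((complex, 'n::finite option) vec) set" and \<rho> :: "(complex, 'n option) vec \<Rightarrow> real"
  assumes U: "open U" and smooth: "smooth_on U \<rho>" and M: "M = {z\<in>U. \<rho> z = 0}"
    and transversal: "\<And>p. p \<in> M \<Longrightarrow> dz None (cpx \<rho>) p \<noteq> 0"
    and flat: "\<And>z j k. z \<in> U \<Longrightarrow> dz j (dzbar k (cpx \<rho>)) z = (if j = k then 1 else 0)"
begin

sublocale real_hypersurface U M \<rho>
proof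
  show "frechet_derivative \<rho> (at p) \<noteq> (\<lambda>v. 0)" if "p \<in> M" for p
  proof
    assume "frechet_derivative \<rho> (at p) = (\<lambda>v. 0)"
    moreover have "(cpx \<rho> has_derivative (\<lambda>v. of_real (frechet_derivative \<rho> (at p) v))) (at p)"
      using that M smooth_on_differentiable[OF smooth]
      by (intro bounded_linear.has_derivative[OF bounded_linear_of_real] has_derivative_frechet) auto
    ultimately have "dz None (cpx \<rho>) p = 0"
      using frechet_derivative_at[of "cpx \<rho>"] by (simp add: dz_def)
    then show False using transversal[OF that] by simp
  qed
qed (use U smooth M in auto)

definition r :: "'n option \<Rightarrow> (complex, 'n option) vec \<Rightarrow> complex" where
  "r j = dz j (cpx \<rho>)"

definition N :: "(complex, 'n option) vec \<Rightarrow> complex" where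
  "N p = (\<Sum>j\<in>UNIV. r j p * cnj (r j p))"

text \<open>The vector orthogonal to \<open>T\<^sup>1\<^sup>,\<^sup>0M\<close> with \<open>\<Sum>\<rho>\<^sub>j \<nu>\<^sub>j = 1\<close>; subtracting the multiple of it
  by \<open>\<Sum>\<rho>\<^sub>j v\<^sub>j\<close> is the orthogonal projection of \<open>v\<close> to \<open>T\<^sup>1\<^sup>,\<^sup>0M\<close>.\<close>

definition nu :: "'n option \<Rightarrow> (complex, 'n option) vec \<Rightarrow> complex" where
  "nu j p = inverse (N p) * cnj (r j p)"

definition theta :: "'n option oneform" where
  "theta p v = \<i> * (\<Sum>j\<in>UNIV. dzbar j (cpx \<rho>) p * v $ Inr j)"

lemma dzbar_eq_r: "p \<in> M \<Longrightarrow> dzbar j (cpx \<rho>) p = cnj (r j p)"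
  using dzbar_\<rho> M_sub by (auto simp: r_def)

lemma r_None_nonzero: "p \<in> M \<Longrightarrow> r None p \<noteq> 0"
  using transversal by (simp add: r_def)

lemma N_nonzero: "p \<in> M \<Longrightarrow> N p \<noteq> 0"
proof -
  assume p: "p \<in> M"
  have "N p = of_real (\<Sum>j\<in>UNIV. (cmod (r j p))\<^sup>2)"
    by (simp add: N_def complex_norm_square[symmetric])
  moreover have "(\<Sum>j\<in>UNIV. (cmod (r j p))\<^sup>2) \<noteq> 0"
    using r_None_nonzero[OF p] by (subst sum_nonneg_eq_0_iff) auto
  ultimately show ?thesis by (simp only: of_real_eq_0_iff not_False_eq_True)
qed

lemma smooth_along_r: "smooth_along M (r j)"
  unfolding r_def by (rule smooth_along_wirt_\<rho>)

lemma smooth_along_cnj_r: "smooth_along M (\<lambda>q. cnj (r j q))"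
  by (rule smooth_along_cnj[OF smooth_along_r])

lemma smooth_along_inverse_N: "smooth_along M (\<lambda>q. inverse (N q))"
  unfolding N_def
  by (intro smooth_along_inverse smooth_along_sum smooth_along_mult smooth_along_r smooth_along_cnj_r)
     (use N_nonzero in \<open>auto simp: N_def\<close>)

lemma smooth_along_nu: "smooth_along M (nu j)"
  unfolding nu_def[abs_def] by (intro smooth_along_mult smooth_along_inverse_N smooth_along_cnj_r)

lemma vfieldD: "vfield M \<rho> X \<Longrightarrow> p \<in> M \<Longrightarrow>
    (\<Sum>j\<in>UNIV. r j p * X p $ Inl j) + (\<Sum>j\<in>UNIV. cnj (r j p) * X p $ Inr j) = 0"
  by (simp add: vfield_def r_def[symmetric] dzbar_eq_r sum.distrib)

lemma vfield10D:
  assumes "vfield10 M \<rho> X"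
  shows "vfield M \<rho> X" and "p \<in> M \<Longrightarrow> X p $ Inr j = 0"
    and "p \<in> M \<Longrightarrow> (\<Sum>j\<in>UNIV. r j p * X p $ Inl j) = 0"
  using assms vfieldD[of X p] by (auto simp: vfield10_def)

lemma vfield01D:
  assumes "vfield01 M \<rho> X"
  shows "vfield M \<rho> X" and "p \<in> M \<Longrightarrow> X p $ Inl j = 0"
  using assms by (auto simp: vfield01_def)

lemma vfield01_fconj: "vfield10 M \<rho> X \<Longrightarrow> vfield01 M \<rho> (fconj X)"
  by (auto simp: vfield10_def vfield01_def vfield_fconj) (simp add: fconj_def)

lemma smooth_along_comp: "vfield M \<rho> X \<Longrightarrow> smooth_along M (\<lambda>q. X q $ i)"
  by (auto simp: vfield_iff intro: smooth_along_nth)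

text \<open>This is where the hypothesis on the complex Hessian enters: the mixed derivatives of \<open>\<rho>\<close>
  contribute the vector itself.\<close>

lemma act_dzbar_\<rho>:
  assumes "p \<in> M" "vfield M \<rho> X"
  shows "act M X (dzbar j (cpx \<rho>)) p = X p $ Inl j + (\<Sum>k\<in>UNIV. X p $ Inr k * dzbar k (dzbar j (cpx \<rho>)) p)"
proof -
  have "smooth_on U (dzbar j (cpx \<rho>))" using smooth_on_wirt[OF U smooth_on_cpx_\<rho>, of "Inr j"] by simp
  from act_eq_smooth_on[OF assms this]
  show ?thesis using assms(1) M_sub flat by (auto simp: sum_Inl_Inr subset_iff if_distrib[of "\<lambda>x. _ * x"] cong: if_cong)
qed

lemma act_cnj_r:
  assumes "p \<in> M" "vfield10 M \<rho> X"
  shows "act M X (\<lambda>q. cnj (r j q)) p = X p $ Inl j"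
proof -
  have "act M X (\<lambda>q. cnj (r j q)) p = act M X (dzbar j (cpx \<rho>)) p"
    by (rule act_cong[OF assms(1)]) (simp add: dzbar_eq_r)
  then show ?thesis using act_dzbar_\<rho>[OF assms(1) vfield10D(1)[OF assms(2)]] vfield10D(2)[OF assms(2)] assms(1) by simp
qed

lemma act_fconj_r:
  assumes "p \<in> M" "vfield10 M \<rho> X"
  shows "act M (fconj X) (r j) p = cnj (X p $ Inl j)"
  using act_fconj[OF assms(1) vfield10D(1)[OF assms(2)] smooth_along_cnj_r[of j]] act_cnj_r[OF assms] by simp

text \<open>\<open>d\<theta> = \<i> \<Sum> dz\<^sub>j \<and> dz'\<^sub>j\<close> (with \<open>dz'\<^sub>j\<close> the conjugate of \<open>dz\<^sub>j\<close>) is the flat Kaehler form: in \<open>X (\<theta> Y) - Y (\<theta> X) - \<theta> [X, Y]\<close> the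
  derivatives of the components of the fields cancel against the bracket, and the purely
  antiholomorphic second derivatives of \<open>\<rho>\<close> cancel by symmetry.\<close>

lemma ext_deriv_theta:
  assumes p: "p \<in> M" and X: "vfield M \<rho> X" and Y: "vfield M \<rho> Y"
  shows "ext_deriv M theta X Y p = \<i> * (\<Sum>j\<in>UNIV. X p $ Inl j * Y p $ Inr j - Y p $ Inl j * X p $ Inr j)"
proof -
  have half: "act M A (\<lambda>q. theta q (B q)) p
      = \<i> * ((\<Sum>j\<in>UNIV. A p $ Inl j * B p $ Inr j)
          + (\<Sum>j\<in>UNIV. \<Sum>k\<in>UNIV. A p $ Inr k * B p $ Inr j * dzbar k (dzbar j (cpx \<rho>)) p))
        + theta p (\<chi> i. act M A (\<lambda>q. B q $ i) p)"
    if A: "vfield M \<rho> A" and B: "vfield M \<rho> B" for A B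
  proof -
    note sB = smooth_along_comp[OF B] and s\<rho> = smooth_along_wirt_\<rho>(2)
    have "act M A (\<lambda>q. theta q (B q)) p
        = \<i> * (\<Sum>j\<in>UNIV. act M A (dzbar j (cpx \<rho>)) p * B p $ Inr j + dzbar j (cpx \<rho>) p * act M A (\<lambda>q. B q $ Inr j) p)"
      unfolding theta_def
      by (simp add: act_mult[OF p A] act_sum[OF p A] act_const[OF p A] sB s\<rho> smooth_along_const smooth_along_mult smooth_along_sum)
    also have "\<dots> = \<i> * ((\<Sum>j\<in>UNIV. A p $ Inl j * B p $ Inr j)
          + (\<Sum>j\<in>UNIV. \<Sum>k\<in>UNIV. A p $ Inr k * B p $ Inr j * dzbar k (dzbar j (cpx \<rho>)) p))
        + theta p (\<chi> i. act M A (\<lambda>q. B q $ i) p)"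
      by (simp add: act_dzbar_\<rho>[OF p A] theta_def distrib_right distrib_left sum.distrib sum_distrib_left sum_distrib_right mult_ac)
    finally show ?thesis .
  qed
  have "dzbar k (dzbar j (cpx \<rho>)) p = dzbar j (dzbar k (cpx \<rho>)) p" for j k
    using wirt_commute[OF U _ smooth_on_cpx_\<rho>, of p "Inr k" "Inr j"] p M_sub by auto
  then have sym: "(\<Sum>j\<in>UNIV. \<Sum>k\<in>UNIV. X p $ Inr k * Y p $ Inr j * dzbar k (dzbar j (cpx \<rho>)) p)
      = (\<Sum>j\<in>UNIV. \<Sum>k\<in>UNIV. Y p $ Inr k * X p $ Inr j * dzbar k (dzbar j (cpx \<rho>)) p)"
    by (subst sum.swap) (simp add: mult.commute)
  have br: "theta p (bracket M X Y p) = theta p (\<chi> i. act M X (\<lambda>q. Y q $ i) p) - theta p (\<chi> i. act M Y (\<lambda>q. X q $ i) p)"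
    by (simp add: theta_def bracket_def right_diff_distrib sum_subtractf)
  show ?thesis
    unfolding ext_deriv_def half[OF X Y] half[OF Y X] br sym
    by (simp add: sum_subtractf right_diff_distrib distrib_left)
qed

lemma levi_pair_theta:
  assumes p: "p \<in> M" and X: "vfield M \<rho> X" and Y: "vfield10 M \<rho> Y"
  shows "levi_pair M theta X (fconj Y) p = (\<Sum>j\<in>UNIV. X p $ Inl j * cnj (Y p $ Inl j))"
  using ext_deriv_theta[OF p X vfield_fconj[OF vfield10D(1)[OF Y]]] vfield10D(2)[OF Y p]
  by (simp add: levi_pair_def fconj_def)

subsection \<open>The graph frame\<close>

lemma sum_option: "(\<Sum>j\<in>UNIV. g j) = g None + (\<Sum>\<alpha>\<in>UNIV. g (Some \<alpha>))"
  for g :: "'k::finite option \<Rightarrow> 'b::comm_monoid_add"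
  by (simp add: UNIV_option_conv sum.reindex)

abbreviation Z :: "'n \<Rightarrow> 'n option cfield" where "Z \<equiv> cr_frame \<rho>"

lemma Z_nth:
  "Z \<alpha> p $ Inl (Some \<beta>) = (if \<beta> = \<alpha> then 1 else 0)"
  "Z \<alpha> p $ Inl None = - (r (Some \<alpha>) p / r None p)"
  "Z \<alpha> p $ Inr j = 0"
  by (auto simp: cr_frame_def axis_def r_def)

lemma vfield10_Z: "vfield10 M \<rho> (Z \<alpha>)"
proof -
  have "smooth_along M (\<lambda>q. - (r (Some \<alpha>) q * inverse (r None q)))"
    by (intro smooth_along_minus smooth_along_mult smooth_along_inverse smooth_along_r r_None_nonzero)
  then have None: "smooth_along M (\<lambda>q. Z \<alpha> q $ Inl None)"
    by (simp add: Z_nth field_class.field_divide_inverse)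
  have "smooth_along M (\<lambda>q. Z \<alpha> q $ i)" for i
  proof (cases i)
    case (Inl j)
    then show ?thesis using None by (cases j) (simp_all add: Z_nth(1) smooth_along_const)
  qed (simp add: Z_nth smooth_along_const)
  then have "smooth_along M (Z \<alpha>)" by (rule smooth_along_vecI)
  moreover have "(\<Sum>j\<in>UNIV. dz j (cpx \<rho>) p * Z \<alpha> p $ Inl j) = 0" if "p \<in> M" for p
    using r_None_nonzero[OF that]
    by (simp add: sum_option r_def[symmetric] Z_nth if_distrib[of "\<lambda>x. _ * x"] cong: if_cong)
  ultimately show ?thesis
    by (simp add: vfield10_def vfield_def Z_nth(3))
qed

text \<open>The frame fields span \<open>T\<^sup>1\<^sup>,\<^sup>0M\<close>, whose orthogonal complement is the line of \<open>\<nu>\<close>. The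
  coefficient is found by pairing with \<open>\<rho>\<^sub>k\<close>.\<close>

lemma orthogonal_frame_imp_parallel:
  assumes "p \<in> M" "\<And>\<alpha>. (\<Sum>j\<in>UNIV. a j * cnj (Z \<alpha> p $ Inl j)) = 0"
  shows "a j = (\<Sum>k\<in>UNIV. r k p * a k) * nu j p"
proof -
  define c where "c = a None / cnj (r None p)"
  have a: "a j = c * cnj (r j p)" for j
  proof (cases j)
    case None
    then show ?thesis using r_None_nonzero[OF assms(1)] by (simp add: c_def)
  next
    case (Some \<beta>)
    then show ?thesis using assms(2)[of \<beta>]
      by (simp add: c_def sum_option Z_nth if_distrib[of "\<lambda>x. _ * x"] if_distrib[of cnj] cong: if_cong)
  qed
  have "(\<Sum>k\<in>UNIV. r k p * a k) = c * N p"
    by (simp add: a N_def sum_distrib_left mult_ac)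
  then show ?thesis using N_nonzero[OF assms(1)] a[of j] by (simp add: nu_def)
qed

lemma orthogonal_nu: "p \<in> M \<Longrightarrow> vfield10 M \<rho> W \<Longrightarrow> (\<Sum>j\<in>UNIV. nu j p * cnj (W p $ Inl j)) = 0"
proof -
  assume "p \<in> M" "vfield10 M \<rho> W"
  then have "cnj (\<Sum>j\<in>UNIV. r j p * W p $ Inl j) = 0" using vfield10D(3) by simp
  then show ?thesis by (simp add: nu_def mult.assoc sum_distrib_left[symmetric])
qed

text \<open>The derivative of the normalising factor \<open>1 / |\<partial>\<rho>|\<^sup>2\<close> contributes a multiple of \<open>\<nu>\<close>, which
  is orthogonal to \<open>W\<close>.\<close>

lemma pair_act_nu:
  assumes p: "p \<in> M" and V: "vfield M \<rho> V" and W: "vfield10 M \<rho> W"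
  shows "(\<Sum>j\<in>UNIV. act M V (nu j) p * cnj (W p $ Inl j))
       = (\<Sum>j\<in>UNIV. act M V (\<lambda>q. cnj (r j q)) p * cnj (W p $ Inl j)) / N p"
proof -
  have "act M V (nu j) p = act M V (\<lambda>q. inverse (N q)) p * cnj (r j p) + inverse (N p) * act M V (\<lambda>q. cnj (r j q)) p" for j
    unfolding nu_def[abs_def] by (rule act_mult[OF p V smooth_along_inverse_N smooth_along_cnj_r])
  moreover have "cnj (r j p) = N p * nu j p" for j using N_nonzero[OF p] by (simp add: nu_def)
  ultimately have "(\<Sum>j\<in>UNIV. act M V (nu j) p * cnj (W p $ Inl j))
     = act M V (\<lambda>q. inverse (N q)) p * N p * (\<Sum>j\<in>UNIV. nu j p * cnj (W p $ Inl j))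
       + inverse (N p) * (\<Sum>j\<in>UNIV. act M V (\<lambda>q. cnj (r j q)) p * cnj (W p $ Inl j))"
    by (simp add: distrib_right sum.distrib sum_distrib_left mult.assoc)
  then show ?thesis by (simp add: orthogonal_nu[OF p W] field_class.field_divide_inverse mult.commute)
qed

text \<open>Differentiating \<open>\<Sum>\<rho>\<^sub>k Y\<^sub>k = 0\<close> along \<open>M\<close>.\<close>

lemma r_act:
  assumes p: "p \<in> M" and V: "vfield M \<rho> V" and Y: "vfield10 M \<rho> Y"
  shows "(\<Sum>k\<in>UNIV. r k p * act M V (\<lambda>q. Y q $ Inl k) p) = - (\<Sum>k\<in>UNIV. act M V (r k) p * Y p $ Inl k)"
proof -
  note sY = smooth_along_comp[OF vfield10D(1)[OF Y]]
  have "act M V (\<lambda>q. \<Sum>k\<in>UNIV. r k q * Y q $ Inl k) p = act M V (\<lambda>q. 0) p"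
    by (rule act_cong[OF p]) (rule vfield10D(3)[OF Y])
  then have "(\<Sum>k\<in>UNIV. act M V (r k) p * Y p $ Inl k + r k p * act M V (\<lambda>q. Y q $ Inl k) p) = 0"
    by (simp add: act_const[OF p V] act_sum[OF p V] act_mult[OF p V] smooth_along_mult smooth_along_r sY)
  then show ?thesis by (simp add: sum.distrib add_eq_0_iff2 add.commute)
qed

end

section \<open>The Tanaka--Webster connection in the flat case\<close>

locale flat_tanaka_webster = flat_hypersurface U M \<rho>
  for U M :: "((complex, 'n::finite option) vec) set" and \<rho> :: "(complex, 'n option) vec \<Rightarrow> real" +
  fixes T :: "'n option cfield" and nab :: "'n option connection"
  assumes reeb: "reeb_field M \<rho> theta T" and tw: "tanaka_webster M \<rho> theta T nab"
begin

lemma vfield_T: "vfield M \<rho> T"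
  using reeb by (simp add: reeb_field_def)

text \<open>Contracting \<open>d\<theta>\<close> with \<open>T\<close> and the frame shows that the \<open>(0,1)\<close> part of \<open>T\<close> is a
  multiple of the conjugate of \<open>\<nu>\<close>; the factor comes from \<open>\<theta>(T) = 1\<close>, and the \<open>(1,0)\<close> part from
  the reality of \<open>T\<close>.\<close>

lemma T_nth:
  assumes p: "p \<in> M"
  shows "T p $ Inl j = \<i> * nu j p" "T p $ Inr j = - \<i> * cnj (nu j p)"
proof -
  have "cnj (\<Sum>j\<in>UNIV. cnj (T p $ Inr j) * cnj (Z \<alpha> p $ Inl j)) = 0" for \<alpha>
  proof -
    have "ext_deriv M theta T (Z \<alpha>) p = 0"
      using reeb vfield10D(1)[OF vfield10_Z] p by (simp add: reeb_field_def)
    then show ?thesis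
      using ext_deriv_theta[OF p vfield_T vfield10D(1)[OF vfield10_Z], of \<alpha>] by (simp add: Z_nth(3) sum_negf mult.commute)
  qed
  then have "cnj (T p $ Inr j) = (\<Sum>k\<in>UNIV. r k p * cnj (T p $ Inr k)) * nu j p" for j
    by (intro orthogonal_frame_imp_parallel[OF p]) (simp only: complex_cnj_zero_iff)
  moreover have "(\<Sum>k\<in>UNIV. r k p * cnj (T p $ Inr k)) = \<i>"
  proof -
    have "theta p (T p) = 1" using reeb p by (simp add: reeb_field_def)
    then have "cnj (\<i> * (\<Sum>k\<in>UNIV. cnj (r k p) * T p $ Inr k)) = 1"
      by (simp add: theta_def dzbar_eq_r[OF p])
    then show ?thesis by (simp add: complex_eq_iff)
  qed
  ultimately have *: "cnj (T p $ Inr j) = \<i> * nu j p" for j by simp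
  have "vconj (T p) = T p" using reeb p by (simp add: reeb_field_def)
  then have "T p $ Inl j = cnj (T p $ Inr j)" by (metis vconj_nth(1))
  then show "T p $ Inl j = \<i> * nu j p" using * by simp
  show "T p $ Inr j = - \<i> * cnj (nu j p)" using arg_cong[OF *[of j], of cnj] by simp
qed

lemma linear_connection_nab: "linear_connection M \<rho> nab"
  using tw by (simp add: tanaka_webster_def)

lemma vfield_nab: "vfield M \<rho> X \<Longrightarrow> vfield M \<rho> Y \<Longrightarrow> vfield M \<rho> (nab X Y)"
  using linear_connection_nab by (simp add: linear_connection_def)

lemma nab_add_left:
  "vfield M \<rho> X \<Longrightarrow> vfield M \<rho> X' \<Longrightarrow> vfield M \<rho> Y \<Longrightarrow> p \<in> M \<Longrightarrow>
    nab (\<lambda>q. X q + X' q) Y p = nab X Y p + nab X' Y p"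
  using linear_connection_nab by (simp add: linear_connection_def)

lemma nab_scale_left:
  "smooth_along M f \<Longrightarrow> vfield M \<rho> X \<Longrightarrow> vfield M \<rho> Y \<Longrightarrow> p \<in> M \<Longrightarrow>
    nab (\<lambda>q. f q *s X q) Y p = f p *s nab X Y p"
  using linear_connection_nab by (simp add: linear_connection_def)

lemma nab_conj:
  "vfield M \<rho> X \<Longrightarrow> vfield M \<rho> Y \<Longrightarrow> p \<in> M \<Longrightarrow> nab (fconj X) (fconj Y) p = vconj (nab X Y p)"
  using linear_connection_nab by (simp add: linear_connection_def)

lemma vfield10_nab: "vfield M \<rho> X \<Longrightarrow> vfield10 M \<rho> Y \<Longrightarrow> vfield10 M \<rho> (nab X Y)"
  using tw by (simp add: tanaka_webster_def)

lemma theta_parallel: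
  "vfield M \<rho> X \<Longrightarrow> vfield M \<rho> Y \<Longrightarrow> p \<in> M \<Longrightarrow> act M X (\<lambda>q. theta q (Y q)) p = theta p (nab X Y p)"
  using tw by (simp add: tanaka_webster_def)

lemma ext_deriv_parallel:
  "vfield M \<rho> X \<Longrightarrow> vfield M \<rho> Y \<Longrightarrow> vfield M \<rho> W \<Longrightarrow> p \<in> M \<Longrightarrow>
    act M X (ext_deriv M theta Y W) p = ext_deriv M theta (nab X Y) W p + ext_deriv M theta Y (nab X W) p"
  using tw by (simp add: tanaka_webster_def)

lemma torsion_10_01:
  "vfield10 M \<rho> X \<Longrightarrow> vfield01 M \<rho> Y \<Longrightarrow> p \<in> M \<Longrightarrow>
    torsion M nab X Y p = (\<i> * levi_pair M theta X Y p) *s T p"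
  using tw by (simp add: tanaka_webster_def)

lemma torsion_T: "vfield10 M \<rho> X \<Longrightarrow> vfield01 M \<rho> (torsion M nab T X)"
  using tw by (simp add: tanaka_webster_def)

text \<open>A field that vanishes on \<open>M\<close> equals \<open>f\<close> times itself, where \<open>f\<close> is \<open>0\<close> on \<open>M\<close> and \<open>1\<close>
  elsewhere. As \<open>f\<close> is smooth along \<open>M\<close>, linearity over functions gives the claim.\<close>

lemma nab_cong_left:
  assumes "vfield M \<rho> X" "vfield M \<rho> Y" "p \<in> M" "\<And>q. q \<in> M \<Longrightarrow> X q = X' q"
  shows "nab X Y p = nab X' Y p"
proof -
  define f :: "(complex, 'n option) vec \<Rightarrow> complex" where "f q = (if q \<in> M then 0 else 1)" for q
  define D where "D q = X q + (-1) *s X' q" for q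
  have f: "smooth_along M f"
    by (rule smooth_along_cong[OF smooth_along_const[of M 0]]) (simp add: f_def)
  have X': "vfield M \<rho> X'" by (rule vfield_cong[OF assms(1,4)])
  have D: "vfield M \<rho> D"
    unfolding D_def[abs_def] by (intro vfield_add vfield_scale smooth_along_const assms(1) X')
  have "X = (\<lambda>q. X' q + f q *s D q)"
    by (auto simp: f_def D_def assms(4) fun_eq_iff vec_eq_iff)
  then have "nab X Y p = nab X' Y p + nab (\<lambda>q. f q *s D q) Y p"
    using nab_add_left[OF X' vfield_scale[OF f D] assms(2,3)] by simp
  then show ?thesis
    using nab_scale_left[OF f D assms(2,3)] assms(3) by (simp add: f_def vec_eq_iff)
qed

lemma nab_fconj:
  assumes "vfield M \<rho> X" "vfield10 M \<rho> Y" "p \<in> M"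
  shows "nab X (fconj Y) p = vconj (nab (fconj X) Y p)"
  using nab_conj[OF vfield_fconj[OF assms(1)] vfield10D(1)[OF assms(2)] assms(3)] by simp

lemma vfield01_nab_fconj:
  assumes "vfield M \<rho> X" "vfield10 M \<rho> Y"
  shows "vfield01 M \<rho> (nab X (fconj Y))"
  using vfield_nab[OF assms(1) vfield_fconj[OF vfield10D(1)[OF assms(2)]]]
    vfield10D(2)[OF vfield10_nab[OF vfield_fconj[OF assms(1)] assms(2)]] nab_fconj[OF assms]
  by (simp add: vfield01_def)

text \<open>The \<open>(1,0)\<close> part of the torsion identity for \<open>Y\<close> and the conjugate of \<open>X\<close>: the covariant
  derivative of the \<open>(0,1)\<close> field drops out, and \<open>T\<close> contributes the multiple of \<open>\<nu>\<close>.\<close>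

lemma nab_antiholomorphic:
  assumes X: "vfield10 M \<rho> X" and Y: "vfield10 M \<rho> Y" and p: "p \<in> M"
  shows "nab (fconj X) Y p $ Inl j = act M (fconj X) (\<lambda>q. Y q $ Inl j) p
      + (\<Sum>k\<in>UNIV. cnj (X p $ Inl k) * Y p $ Inl k) * nu j p"
proof -
  have "act M Y (\<lambda>q. fconj X q $ Inl j) p = act M Y (\<lambda>q. 0) p"
    by (rule act_cong[OF p]) (simp add: fconj_def vfield10D(2)[OF X])
  then have "bracket M Y (fconj X) p $ Inl j = - act M (fconj X) (\<lambda>q. Y q $ Inl j) p"
    by (simp add: bracket_def act_const[OF p vfield10D(1)[OF Y]])
  moreover have "nab Y (fconj X) p $ Inl j = 0"
    by (rule vfield01D(2)[OF vfield01_nab_fconj[OF vfield10D(1)[OF Y] X] p])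
  ultimately have "torsion M nab Y (fconj X) p $ Inl j
      = act M (fconj X) (\<lambda>q. Y q $ Inl j) p - nab (fconj X) Y p $ Inl j"
    by (simp add: torsion_def)
  moreover have "torsion M nab Y (fconj X) p $ Inl j = - ((\<Sum>k\<in>UNIV. cnj (X p $ Inl k) * Y p $ Inl k) * nu j p)"
    using torsion_10_01[OF Y vfield01_fconj[OF X] p] levi_pair_theta[OF p vfield10D(1)[OF Y] X]
    by (simp add: T_nth[OF p] mult_ac)
  ultimately have "act M (fconj X) (\<lambda>q. Y q $ Inl j) p - nab (fconj X) Y p $ Inl j
      = - ((\<Sum>k\<in>UNIV. cnj (X p $ Inl k) * Y p $ Inl k) * nu j p)" by simp
  then show ?thesis by (simp only: diff_eq_eq) simp
qed

text \<open>In this form, as the flat derivative projected to \<open>T\<^sup>1\<^sup>,\<^sup>0M\<close> along \<open>\<nu>\<close>, the connection has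
  the same shape in \<open>(0,1)\<close> and in \<open>(1,0)\<close> directions.\<close>

lemma nab_projection_01:
  assumes X: "vfield10 M \<rho> X" and Y: "vfield10 M \<rho> Y" and p: "p \<in> M"
  shows "nab (fconj X) Y p $ Inl j = act M (fconj X) (\<lambda>q. Y q $ Inl j) p
      - (\<Sum>k\<in>UNIV. r k p * act M (fconj X) (\<lambda>q. Y q $ Inl k) p) * nu j p"
  using nab_antiholomorphic[OF assms] r_act[OF p vfield_fconj[OF vfield10D(1)[OF X]] Y] act_fconj_r[OF p X]
  by simp

text \<open>Parallelism of \<open>d\<theta>\<close>, tested against the conjugate frame whose derivatives are already known,
  shows that \<open>\<nabla>\<^sub>X Y\<close> and the flat derivative of \<open>Y\<close> have the same product with every frame
  field. So they differ by a multiple of \<open>\<nu>\<close>, which tangency of \<open>\<nabla>\<^sub>X Y\<close> determines.\<close>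

lemma nab_projection_10:
  assumes X: "vfield10 M \<rho> X" and Y: "vfield10 M \<rho> Y" and p: "p \<in> M"
  shows "nab X Y p $ Inl j = act M X (\<lambda>q. Y q $ Inl j) p
      - (\<Sum>k\<in>UNIV. r k p * act M X (\<lambda>q. Y q $ Inl k) p) * nu j p"
proof -
  note vX = vfield10D(1)[OF X] and vY = vfield10D(1)[OF Y]
  define a where "a j = nab X Y p $ Inl j - act M X (\<lambda>q. Y q $ Inl j) p" for j
  have "(\<Sum>j\<in>UNIV. a j * cnj (Z \<alpha> p $ Inl j)) = 0" for \<alpha>
  proof -
    let ?W = "Z \<alpha>"
    note W = vfield10_Z[of \<alpha>]
    note vW = vfield10D(1)[OF W] and cW = vfield_fconj[OF vfield10D(1)[OF W]]
    note sY = smooth_along_comp[OF vY] and sW = smooth_along_comp[OF vW]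
    have "act M X (ext_deriv M theta Y (fconj ?W)) p = act M X (\<lambda>q. \<i> * (\<Sum>j\<in>UNIV. Y q $ Inl j * cnj (?W q $ Inl j))) p"
      by (rule act_cong[OF p]) (simp add: ext_deriv_theta[OF _ vY cW] fconj_nth Z_nth(3))
    also have "\<dots> = \<i> * (\<Sum>j\<in>UNIV. act M X (\<lambda>q. Y q $ Inl j) p * cnj (?W p $ Inl j)
        + Y p $ Inl j * act M X (\<lambda>q. cnj (?W q $ Inl j)) p)"
      by (simp add: act_mult[OF p vX] act_sum[OF p vX] act_const[OF p vX] smooth_along_mult smooth_along_sum
          smooth_along_const smooth_along_cnj sY sW)
    finally have lhs: "act M X (ext_deriv M theta Y (fconj ?W)) p
        = \<i> * ((\<Sum>j\<in>UNIV. act M X (\<lambda>q. Y q $ Inl j) p * cnj (?W p $ Inl j))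
            + (\<Sum>j\<in>UNIV. Y p $ Inl j * act M X (\<lambda>q. cnj (?W q $ Inl j)) p))"
      by (simp add: sum.distrib)
    have rhs1: "ext_deriv M theta (nab X Y) (fconj ?W) p = \<i> * (\<Sum>j\<in>UNIV. nab X Y p $ Inl j * cnj (?W p $ Inl j))"
      by (simp add: ext_deriv_theta[OF p vfield_nab[OF vX vY] cW] fconj_nth Z_nth(3))
    have comp: "nab X (fconj ?W) p $ Inr j = act M X (\<lambda>q. cnj (?W q $ Inl j)) p
        + (\<Sum>k\<in>UNIV. X p $ Inl k * cnj (?W p $ Inl k)) * cnj (nu j p)" for j
    proof -
      have "act M X (\<lambda>q. cnj (?W q $ Inl j)) p = cnj (act M (fconj X) (\<lambda>q. ?W q $ Inl j) p)"
        using act_fconj[OF p vfield_fconj[OF vX] sW, of "Inl j"] by simp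
      then show ?thesis
        using nab_antiholomorphic[OF X W p, of j] nab_fconj[OF vX W p] by simp
    qed
    \<comment> \<open>the \<open>\<nu>\<close>-part of the derivative of the frame field is invisible to \<open>Y\<close>\<close>
    have "cnj (\<Sum>j\<in>UNIV. nu j p * cnj (Y p $ Inl j)) = 0"
      by (simp only: orthogonal_nu[OF p Y] complex_cnj_zero)
    then have ort: "(\<Sum>j\<in>UNIV. Y p $ Inl j * cnj (nu j p)) = 0" by (simp add: mult.commute)
    have "ext_deriv M theta Y (nab X (fconj ?W)) p = \<i> * (\<Sum>j\<in>UNIV. Y p $ Inl j * nab X (fconj ?W) p $ Inr j)"
      using ext_deriv_theta[OF p vY vfield_nab[OF vX cW]] vfield10D(2)[OF Y p] by simp
    also have "(\<Sum>j\<in>UNIV. Y p $ Inl j * nab X (fconj ?W) p $ Inr j)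
        = (\<Sum>j\<in>UNIV. Y p $ Inl j * act M X (\<lambda>q. cnj (?W q $ Inl j)) p)
          + (\<Sum>k\<in>UNIV. X p $ Inl k * cnj (?W p $ Inl k)) * (\<Sum>j\<in>UNIV. Y p $ Inl j * cnj (nu j p))" (is "_ = _ + ?S * _")
    proof -
      have "Y p $ Inl j * nab X (fconj ?W) p $ Inr j
          = Y p $ Inl j * act M X (\<lambda>q. cnj (?W q $ Inl j)) p + ?S * (Y p $ Inl j * cnj (nu j p))" for j
        by (simp only: comp distrib_left mult.left_commute)
      then show ?thesis by (simp only: sum.distrib sum_distrib_left[symmetric])
    qed
    finally have rhs2: "ext_deriv M theta Y (nab X (fconj ?W)) p
        = \<i> * (\<Sum>j\<in>UNIV. Y p $ Inl j * act M X (\<lambda>q. cnj (?W q $ Inl j)) p)"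
      by (simp add: ort)
    have "(\<Sum>j\<in>UNIV. act M X (\<lambda>q. Y q $ Inl j) p * cnj (?W p $ Inl j)) = (\<Sum>j\<in>UNIV. nab X Y p $ Inl j * cnj (?W p $ Inl j))"
      using ext_deriv_parallel[OF vX vY cW p] unfolding lhs rhs1 rhs2 by (simp add: distrib_left)
    then show ?thesis by (simp add: a_def left_diff_distrib sum_subtractf)
  qed
  from orthogonal_frame_imp_parallel[OF p this] have "a j = (\<Sum>k\<in>UNIV. r k p * a k) * nu j p" .
  moreover have "(\<Sum>k\<in>UNIV. r k p * a k) = - (\<Sum>k\<in>UNIV. r k p * act M X (\<lambda>q. Y q $ Inl k) p)"
    by (simp add: a_def right_diff_distrib sum_subtractf vfield10D(3)[OF vfield10_nab[OF vX Y] p])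
  ultimately show ?thesis by (simp add: a_def diff_eq_eq)
qed

text \<open>\<open>T\<close> is characterised by \<open>\<theta>(T) = 1\<close> and \<open>T \<rfloor> d\<theta> = 0\<close>, and both \<open>\<theta>\<close> and \<open>d\<theta>\<close> are
  parallel. Hence \<open>\<nabla>\<^sub>Y T\<close> is annihilated by \<open>\<theta>\<close> and by \<open>d\<theta>\<close>, which leaves only \<open>0\<close>.\<close>

lemma nab_T_zero:
  assumes Y: "vfield M \<rho> Y" and p: "p \<in> M"
  shows "nab Y T p $ Inl j = 0"
proof -
  define V where "V = nab Y T"
  have V: "vfield M \<rho> V" unfolding V_def by (rule vfield_nab[OF Y vfield_T])
  have d0: "ext_deriv M theta V W p = 0" if W: "vfield M \<rho> W" for W
  proof -
    have z: "ext_deriv M theta T W' q = 0" if "vfield M \<rho> W'" "q \<in> M" for W' q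
      using reeb that by (simp add: reeb_field_def)
    have "act M Y (ext_deriv M theta T W) p = act M Y (\<lambda>q. 0) p"
      by (rule act_cong[OF p]) (rule z[OF W])
    then show ?thesis
      using ext_deriv_parallel[OF Y vfield_T W p] z[OF vfield_nab[OF Y W] p] act_const[OF p Y] by (simp add: V_def)
  qed
  have th: "theta p (V p) = 0"
  proof -
    have "act M Y (\<lambda>q. theta q (T q)) p = act M Y (\<lambda>q. 1) p"
      by (rule act_cong[OF p]) (use reeb in \<open>simp add: reeb_field_def\<close>)
    then show ?thesis using theta_parallel[OF Y vfield_T p] act_const[OF p Y] by (simp add: V_def)
  qed
  have "(\<Sum>j\<in>UNIV. V p $ Inl j * cnj (Z \<alpha> p $ Inl j)) = 0" for \<alpha>
    using d0[OF vfield_fconj[OF vfield10D(1)[OF vfield10_Z]], of \<alpha>]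
      ext_deriv_theta[OF p V vfield_fconj[OF vfield10D(1)[OF vfield10_Z]], of \<alpha>] by (simp add: fconj_nth Z_nth(3))
  from orthogonal_frame_imp_parallel[OF p this] have "V p $ Inl j = (\<Sum>k\<in>UNIV. r k p * V p $ Inl k) * nu j p" .
  moreover have "(\<Sum>k\<in>UNIV. r k p * V p $ Inl k) = 0"
    using vfieldD[OF V p] th by (simp add: theta_def dzbar_eq_r[OF p])
  ultimately show ?thesis by (simp add: V_def)
qed

text \<open>The torsion of \<open>T\<close> and \<open>Y\<close> has no \<open>(1,0)\<close> part and \<open>T\<close> is parallel, so the \<open>(1,0)\<close> part
  of \<open>\<nabla>\<^sub>T Y\<close> is that of \<open>[T, Y]\<close>.\<close>

lemma nab_T:
  assumes Y: "vfield10 M \<rho> Y" and p: "p \<in> M"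
  shows "nab T Y p $ Inl j = act M T (\<lambda>q. Y q $ Inl j) p - \<i> * act M Y (nu j) p"
proof -
  note vY = vfield10D(1)[OF Y]
  have "act M Y (\<lambda>q. T q $ Inl j) p = act M Y (\<lambda>q. \<i> * nu j q) p"
    by (rule act_cong[OF p]) (simp add: T_nth)
  then have "act M Y (\<lambda>q. T q $ Inl j) p = \<i> * act M Y (nu j) p"
    by (simp add: act_mult[OF p vY smooth_along_const smooth_along_nu] act_const[OF p vY])
  then show ?thesis
    using vfield01D(2)[OF torsion_T[OF Y] p, of j] nab_T_zero[OF vY p, of j] by (simp add: torsion_def bracket_def)
qed

section \<open>The curvature\<close>

text \<open>The inner derivative is the flat one minus a multiple of \<open>\<nu>\<close>. Differentiating once more and
  pairing with \<open>W\<close>, which is orthogonal to \<open>\<nu>\<close>, only the derivative of \<open>\<nu>\<close> itself survives beside the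
  flat second derivative. The hypotheses on \<open>V\<close> and \<open>V'\<close> hold for \<open>(1,0)\<close> and \<open>(0,1)\<close> fields.\<close>

lemma pair_nab_nab:
  assumes V: "vfield M \<rho> V" and V': "vfield M \<rho> V'" and Y: "vfield10 M \<rho> Y" and W: "vfield10 M \<rho> W" and p: "p \<in> M"
    and proj: "\<And>Y j q. vfield10 M \<rho> Y \<Longrightarrow> q \<in> M \<Longrightarrow> nab V Y q $ Inl j = act M V (\<lambda>q. Y q $ Inl j) q
      - (\<Sum>k\<in>UNIV. r k q * act M V (\<lambda>q. Y q $ Inl k) q) * nu j q"
    and proj': "\<And>j q. q \<in> M \<Longrightarrow> nab V' Y q $ Inl j = act M V' (\<lambda>q. Y q $ Inl j) q
      - (\<Sum>k\<in>UNIV. r k q * act M V' (\<lambda>q. Y q $ Inl k) q) * nu j q"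
  shows "(\<Sum>j\<in>UNIV. nab V (nab V' Y) p $ Inl j * cnj (W p $ Inl j))
    = (\<Sum>j\<in>UNIV. act M V (act M V' (\<lambda>q. Y q $ Inl j)) p * cnj (W p $ Inl j))
      + (\<Sum>k\<in>UNIV. act M V' (r k) p * Y p $ Inl k)
        * (\<Sum>j\<in>UNIV. act M V (\<lambda>q. cnj (r j q)) p * cnj (W p $ Inl j)) / N p"
proof -
  note vY = vfield10D(1)[OF Y] and vW = vfield10D(1)[OF W]
  define c where "c = (\<lambda>q. \<Sum>k\<in>UNIV. r k q * act M V' (\<lambda>q. Y q $ Inl k) q)"
  have sc: "smooth_along M c"
    unfolding c_def by (intro smooth_along_sum smooth_along_mult smooth_along_r smooth_along_act V' smooth_along_comp vY)
  have sa: "smooth_along M (act M V' (\<lambda>q. Y q $ Inl j))" for j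
    by (intro smooth_along_act V' smooth_along_comp vY)
  have inner: "act M V (\<lambda>q. nab V' Y q $ Inl j) p
      = act M V (act M V' (\<lambda>q. Y q $ Inl j)) p - (act M V c p * nu j p + c p * act M V (nu j) p)" for j
  proof -
    have "act M V (\<lambda>q. nab V' Y q $ Inl j) p = act M V (\<lambda>q. act M V' (\<lambda>q. Y q $ Inl j) q - c q * nu j q) p"
      by (rule act_cong[OF p]) (simp add: proj' c_def)
    also have "\<dots> = act M V (act M V' (\<lambda>q. Y q $ Inl j)) p - (act M V c p * nu j p + c p * act M V (nu j) p)"
      by (simp add: act_diff[OF p V sa smooth_along_mult[OF sc smooth_along_nu]] act_mult[OF p V sc smooth_along_nu])
    finally show ?thesis .
  qed
  have outer: "nab V (nab V' Y) p $ Inl j = act M V (act M V' (\<lambda>q. Y q $ Inl j)) p - c p * act M V (nu j) p - d * nu j p"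
    if "d = act M V c p + (\<Sum>k\<in>UNIV. r k p * act M V (\<lambda>q. nab V' Y q $ Inl k) p)" for j d
    using proj[OF vfield10_nab[OF V' Y] p, of j] inner[of j] that by (simp add: algebra_simps)
  obtain d where d: "\<And>j. nab V (nab V' Y) p $ Inl j = act M V (act M V' (\<lambda>q. Y q $ Inl j)) p - c p * act M V (nu j) p - d * nu j p"
    using outer by blast
  have "(\<Sum>j\<in>UNIV. nab V (nab V' Y) p $ Inl j * cnj (W p $ Inl j))
    = (\<Sum>j\<in>UNIV. act M V (act M V' (\<lambda>q. Y q $ Inl j)) p * cnj (W p $ Inl j))
      - c p * (\<Sum>j\<in>UNIV. act M V (nu j) p * cnj (W p $ Inl j)) - d * (\<Sum>j\<in>UNIV. nu j p * cnj (W p $ Inl j))"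
    by (simp add: d left_diff_distrib sum_subtractf sum_distrib_left mult.assoc)
  moreover have "c p = - (\<Sum>k\<in>UNIV. act M V' (r k) p * Y p $ Inl k)"
    unfolding c_def by (rule r_act[OF p V' Y])
  ultimately show ?thesis
    by (simp add: orthogonal_nu[OF p W] pair_act_nu[OF p V W])
qed

text \<open>The mixed torsion identity, read as a formula for the bracket.\<close>

lemma bracket_decomposition:
  assumes X: "vfield10 M \<rho> X" and Y: "vfield10 M \<rho> Y" and q: "q \<in> M"
  shows "bracket M X (fconj Y) q = nab X (fconj Y) q + ((-1) *s nab (fconj Y) X q
      + (- \<i> * (\<Sum>j\<in>UNIV. X q $ Inl j * cnj (Y q $ Inl j))) *s T q)"
proof -
  have "nab X (fconj Y) q - nab (fconj Y) X q - bracket M X (fconj Y) q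
      = (\<i> * (\<Sum>j\<in>UNIV. X q $ Inl j * cnj (Y q $ Inl j))) *s T q"
    using torsion_10_01[OF X vfield01_fconj[OF Y] q] levi_pair_theta[OF q vfield10D(1)[OF X] Y]
    by (simp add: torsion_def)
  then show ?thesis
    by (simp add: vec_eq_iff algebra_simps)
qed

text \<open>By \<open>bracket_decomposition\<close>, the bracket is horizontal up to a multiple of \<open>T\<close>. On the horizontal
  part \<open>\<nabla>\<close> is the flat derivative modulo \<open>\<nu>\<close>; the \<open>T\<close> part brings in the term \<open>D\<^sub>V \<nu>\<close> of
  \<open>nab_T\<close>, which is \<open>V / |\<partial>\<rho>|\<^sup>2\<close> modulo \<open>\<nu>\<close>.\<close>

lemma pair_nab_bracket:
  assumes X: "vfield10 M \<rho> X" and Y: "vfield10 M \<rho> Y" and V: "vfield10 M \<rho> V" and W: "vfield10 M \<rho> W" and p: "p \<in> M"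
  shows "(\<Sum>j\<in>UNIV. nab (bracket M X (fconj Y)) V p $ Inl j * cnj (W p $ Inl j))
    = (\<Sum>j\<in>UNIV. act M (bracket M X (fconj Y)) (\<lambda>q. V q $ Inl j) p * cnj (W p $ Inl j))
      - (\<Sum>j\<in>UNIV. X p $ Inl j * cnj (Y p $ Inl j)) * (\<Sum>j\<in>UNIV. V p $ Inl j * cnj (W p $ Inl j)) / N p"
proof -
  note vX = vfield10D(1)[OF X] and vY = vfield10D(1)[OF Y] and vV = vfield10D(1)[OF V]
  note cY = vfield_fconj[OF vY]
  define A where "A = nab X (fconj Y)"
  define B where "B = nab (fconj Y) X"
  define L where "L q = (\<Sum>j\<in>UNIV. X q $ Inl j * cnj (Y q $ Inl j))" for q
  have A: "vfield M \<rho> A" and B: "vfield10 M \<rho> B" and vB: "vfield M \<rho> B"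
    using vfield_nab[OF vX cY] vfield10_nab[OF cY X] vfield10D(1) by (auto simp: A_def B_def)
  have sL: "smooth_along M (\<lambda>q. - \<i> * L q)"
    unfolding L_def by (intro smooth_along_mult smooth_along_const smooth_along_sum smooth_along_cnj smooth_along_comp vX vY)
  note s1 = smooth_along_const[of M "-1::complex"]
  note vB' = vfield_scale[OF s1 vB] and vT' = vfield_scale[OF sL vfield_T]
  have br: "bracket M X (fconj Y) q = A q + ((-1) *s B q + (- \<i> * L q) *s T q)" if "q \<in> M" for q
    using bracket_decomposition[OF X Y that] by (simp add: A_def B_def L_def)
  have nabs: "nab (bracket M X (fconj Y)) V p = nab A V p + ((-1) *s nab B V p + (- \<i> * L p) *s nab T V p)"
    using nab_cong_left[OF vfield_bracket[OF vX cY] vV p br]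
    by (simp only: nab_add_left[OF A vfield_add[OF vB' vT'] vV p] nab_add_left[OF vB' vT' vV p]
        nab_scale_left[OF s1 vB vV p] nab_scale_left[OF sL vfield_T vV p])
  have acts: "act M (bracket M X (fconj Y)) f p = act M A f p - act M B f p - \<i> * L p * act M T f p"
    if f: "smooth_along M f" for f
  proof -
    have "act M (bracket M X (fconj Y)) f p = act M (\<lambda>q. A q + ((-1) *s B q + (- \<i> * L q) *s T q)) f p"
      by (rule act_field_cong) (rule br[OF p])
    also have "\<dots> = act M A f p - act M B f p - \<i> * L p * act M T f p"
      by (simp only: act_field_add[OF p A vfield_add[OF vB' vT'] f] act_field_add[OF p vB' vT' f]
          act_field_scale[OF p vB f s1] act_field_scale[OF p vfield_T f sL]) simp
    finally show ?thesis .
  qed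
  have Aconj: "nab A V p $ Inl j = act M A (\<lambda>q. V q $ Inl j) p
      - (\<Sum>k\<in>UNIV. r k p * act M A (\<lambda>q. V q $ Inl k) p) * nu j p" for j
  proof -
    have f: "fconj (fconj A) = A" and "vfield10 M \<rho> (fconj A)"
      using vfield01_nab_fconj[OF vX Y] vfield_fconj[OF A] by (simp_all add: A_def vfield10_def vfield01_def fconj_def)
    then show ?thesis using nab_projection_01[of "fconj A" V p j] V p by simp
  qed
  obtain c where c: "\<And>j. nab (bracket M X (fconj Y)) V p $ Inl j
      = act M (bracket M X (fconj Y)) (\<lambda>q. V q $ Inl j) p - L p * act M V (nu j) p + c * nu j p"
  proof
    show "nab (bracket M X (fconj Y)) V p $ Inl j
      = act M (bracket M X (fconj Y)) (\<lambda>q. V q $ Inl j) p - L p * act M V (nu j) p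
        + ((\<Sum>k\<in>UNIV. r k p * act M B (\<lambda>q. V q $ Inl k) p) - (\<Sum>k\<in>UNIV. r k p * act M A (\<lambda>q. V q $ Inl k) p)) * nu j p" for j
      by (simp add: nabs acts[OF smooth_along_comp[OF vV]] Aconj nab_projection_10[OF B V p] nab_T[OF V p])
         (simp add: algebra_simps)
  qed
  have "(\<Sum>j\<in>UNIV. nab (bracket M X (fconj Y)) V p $ Inl j * cnj (W p $ Inl j))
    = (\<Sum>j\<in>UNIV. act M (bracket M X (fconj Y)) (\<lambda>q. V q $ Inl j) p * cnj (W p $ Inl j))
      - L p * (\<Sum>j\<in>UNIV. act M V (nu j) p * cnj (W p $ Inl j)) + c * (\<Sum>j\<in>UNIV. nu j p * cnj (W p $ Inl j))"
    by (simp add: c left_diff_distrib distrib_right sum.distrib sum_subtractf sum_distrib_left mult.assoc)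
  then show ?thesis
    by (simp add: orthogonal_nu[OF p W] pair_act_nu[OF p vV W] act_cnj_r[OF p V] L_def)
qed

text \<open>The second derivative of \<open>\<rho>\<close> along \<open>(1,0)\<close> fields: as \<open>\<Sum>\<rho>\<^sub>k Y\<^sub>k = 0\<close>, it equals
  \<open>- \<Sum>\<rho>\<^sub>k (X Y\<^sub>k)\<close>, the coefficient of \<open>\<nu>\<close> in the flat derivative of \<open>Y\<close> up to sign.\<close>

definition hess :: "'n option cfield \<Rightarrow> 'n option cfield \<Rightarrow> (complex, 'n option) vec \<Rightarrow> complex" where
  "hess X Y p = (\<Sum>k\<in>UNIV. act M X (r k) p * Y p $ Inl k)"

text \<open>The three flat second-order terms cancel because the flat derivative satisfies
  \<open>D\<^sub>X D\<^sub>Y - D\<^sub>Y D\<^sub>X = D\<^sub>[\<^sub>X\<^sub>,\<^sub>Y\<^sub>]\<close> (\<open>act_bracket\<close>); the correction terms of the two pairing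
  formulas remain.\<close>

lemma levi_pair_curvature:
  assumes X: "vfield10 M \<rho> X" and Y: "vfield10 M \<rho> Y" and V: "vfield10 M \<rho> V" and W: "vfield10 M \<rho> W" and p: "p \<in> M"
  defines "L \<equiv> \<lambda>A B. levi_pair M theta A (fconj B) p"
  shows "levi_pair M theta (curvature M nab X (fconj Y) V) (fconj W) p
    = (L X Y * L V W + L X W * L V Y - hess X V p * cnj (hess Y W p)) / N p"
proof -
  note vX = vfield10D(1)[OF X] and vY = vfield10D(1)[OF Y] and vV = vfield10D(1)[OF V]
  note cY = vfield_fconj[OF vY]
  let ?cW = "\<lambda>j. cnj (W p $ Inl j)" and ?V = "\<lambda>j q. V q $ Inl j"
  have vR: "vfield M \<rho> (curvature M nab X (fconj Y) V)"
  proof -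
    have "vfield M \<rho> (\<lambda>q. nab X (nab (fconj Y) V) q + ((-1) *s nab (fconj Y) (nab X V) q + (-1) *s nab (bracket M X (fconj Y)) V q))"
      by (intro vfield_add vfield_scale smooth_along_const vfield_nab vX cY vV vfield_bracket)
    then show ?thesis
      by (rule vfield_cong) (simp add: curvature_def vec_eq_iff)
  qed
  have p1: "(\<Sum>j\<in>UNIV. nab X (nab (fconj Y) V) p $ Inl j * ?cW j)
    = (\<Sum>j\<in>UNIV. act M X (act M (fconj Y) (?V j)) p * ?cW j)
      + (\<Sum>k\<in>UNIV. V p $ Inl k * cnj (Y p $ Inl k)) * (\<Sum>j\<in>UNIV. X p $ Inl j * ?cW j) / N p"
    using pair_nab_nab[OF vX cY V W p nab_projection_10[OF X] nab_projection_01[OF Y V]]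
    by (simp add: act_cnj_r[OF p X] act_fconj_r[OF p Y] mult.commute)
  have "act M (fconj Y) (\<lambda>q. cnj (r j q)) p = cnj (act M Y (r j) p)" for j
    by (rule act_fconj[OF p vY smooth_along_r])
  then have p2: "(\<Sum>j\<in>UNIV. nab (fconj Y) (nab X V) p $ Inl j * ?cW j)
    = (\<Sum>j\<in>UNIV. act M (fconj Y) (act M X (?V j)) p * ?cW j) + hess X V p * cnj (hess Y W p) / N p"
    using pair_nab_nab[OF cY vX V W p nab_projection_01[OF Y] nab_projection_10[OF X V]]
    by (simp add: hess_def)
  have comm: "(\<Sum>j\<in>UNIV. act M (bracket M X (fconj Y)) (?V j) p * ?cW j)
    = (\<Sum>j\<in>UNIV. act M X (act M (fconj Y) (?V j)) p * ?cW j) - (\<Sum>j\<in>UNIV. act M (fconj Y) (act M X (?V j)) p * ?cW j)"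
    by (simp add: act_bracket[OF p vX cY smooth_along_comp[OF vV]] left_diff_distrib sum_subtractf)
  have "levi_pair M theta (curvature M nab X (fconj Y) V) (fconj W) p
    = (\<Sum>j\<in>UNIV. nab X (nab (fconj Y) V) p $ Inl j * ?cW j) - (\<Sum>j\<in>UNIV. nab (fconj Y) (nab X V) p $ Inl j * ?cW j)
      - (\<Sum>j\<in>UNIV. nab (bracket M X (fconj Y)) V p $ Inl j * ?cW j)"
    by (simp add: levi_pair_theta[OF p vR W] curvature_def left_diff_distrib sum_subtractf)
  also have "\<dots> = (L X Y * L V W + L X W * L V Y - hess X V p * cnj (hess Y W p)) / N p"
    unfolding p1 p2 pair_nab_bracket[OF X Y V W p] comm L_def
      levi_pair_theta[OF p vX Y] levi_pair_theta[OF p vX W] levi_pair_theta[OF p vV Y] levi_pair_theta[OF p vV W]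
    by (simp add: diff_divide_distrib add_divide_distrib mult.commute)
  finally show ?thesis .
qed

end

section \<open>Contractions with the inverse Levi matrix\<close>

lemma matrix_inv_mat_1: "matrix_inv (mat 1 :: 'a::semiring_1 ^ 'k ^ 'k) = mat 1"
proof -
  have "(mat 1 :: 'a ^ 'k ^ 'k) ** mat 1 = mat 1 \<and> (mat 1 :: 'a ^ 'k ^ 'k) ** mat 1 = mat 1" by simp
  from someI[of "\<lambda>B. (mat 1 :: 'a ^ 'k ^ 'k) ** B = mat 1 \<and> B ** mat 1 = mat 1", OF this]
  show ?thesis by (simp add: matrix_inv_def)
qed

text \<open>If \<open>H x = 0\<close> and \<open>v = \<Sum> x\<^sub>\<beta> cnj Z\<^sub>\<beta>\<close>, then \<open>|v|\<^sup>2\<close> is the Hermitian form of \<open>H\<close> at \<open>x\<close>,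
  so that \<open>v = 0\<close>; linear independence of the \<open>Z\<^sub>\<beta>\<close>, which is the hypothesis, gives \<open>x = 0\<close>.\<close>

lemma Gram_matrix_invertible:
  fixes Z :: "'k::finite \<Rightarrow> 'm::finite \<Rightarrow> complex"
  assumes "\<And>x. \<forall>j. (\<Sum>\<beta>\<in>UNIV. cnj (Z \<beta> j) * x \<beta>) = 0 \<Longrightarrow> \<forall>\<beta>. x \<beta> = 0"
  defines "H \<equiv> (\<chi> \<alpha> \<beta>. \<Sum>j\<in>UNIV. Z \<alpha> j * cnj (Z \<beta> j)) :: complex ^ 'k ^ 'k"
  shows "H ** matrix_inv H = mat 1" "matrix_inv H ** H = mat 1"
proof -
  have "x = 0" if "H *v x = 0" for x
  proof -
    define v where "v j = (\<Sum>\<beta>\<in>UNIV. cnj (Z \<beta> j) * x $ \<beta>)" for j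
    have Hx: "(\<Sum>j\<in>UNIV. Z \<alpha> j * v j) = 0" for \<alpha>
    proof -
      have "(\<Sum>j\<in>UNIV. Z \<alpha> j * v j) = (\<Sum>j\<in>UNIV. \<Sum>\<beta>\<in>UNIV. Z \<alpha> j * cnj (Z \<beta> j) * x $ \<beta>)"
        by (simp add: v_def sum_distrib_left mult.assoc)
      also have "\<dots> = (\<Sum>\<beta>\<in>UNIV. \<Sum>j\<in>UNIV. Z \<alpha> j * cnj (Z \<beta> j) * x $ \<beta>)" by (rule sum.swap)
      also have "\<dots> = (H *v x) $ \<alpha>" by (simp add: H_def matrix_vector_mult_def sum_distrib_right)
      finally show ?thesis using that by simp
    qed
    have "(\<Sum>j\<in>UNIV. of_real ((cmod (v j))\<^sup>2)) = (\<Sum>j\<in>UNIV. cnj (v j) * v j)"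
      by (simp add: complex_norm_square mult.commute del: of_real_power)
    also have "\<dots> = (\<Sum>j\<in>UNIV. \<Sum>\<alpha>\<in>UNIV. cnj (x $ \<alpha>) * (Z \<alpha> j * v j))"
    proof (rule sum.cong[OF refl])
      fix j
      have "cnj (v j) = (\<Sum>\<alpha>\<in>UNIV. cnj (x $ \<alpha>) * Z \<alpha> j)" by (simp add: v_def mult.commute)
      then show "cnj (v j) * v j = (\<Sum>\<alpha>\<in>UNIV. cnj (x $ \<alpha>) * (Z \<alpha> j * v j))"
        by (simp only: sum_distrib_right mult.assoc)
    qed
    also have "\<dots> = (\<Sum>\<alpha>\<in>UNIV. \<Sum>j\<in>UNIV. cnj (x $ \<alpha>) * (Z \<alpha> j * v j))" by (rule sum.swap)
    also have "\<dots> = 0" by (simp add: sum_distrib_left[symmetric] Hx)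
    finally have "of_real (\<Sum>j\<in>UNIV. (cmod (v j))\<^sup>2) = (0::complex)" by simp
    then have "(\<Sum>j\<in>UNIV. (cmod (v j))\<^sup>2) = 0" by (simp only: of_real_eq_0_iff)
    then have "v j = 0" for j by (subst (asm) sum_nonneg_eq_0_iff) auto
    then show "x = 0" using assms(1)[of "\<lambda>\<beta>. x $ \<beta>"] by (simp add: v_def vec_eq_iff)
  qed
  then have "invertible H"
    using matrix_left_invertible_ker[of H] invertible_left_inverse[of H] by blast
  then have "\<exists>B. H ** B = mat 1 \<and> B ** H = mat 1" by (simp add: invertible_def)
  from someI_ex[OF this] show "H ** matrix_inv H = mat 1" "matrix_inv H ** H = mat 1"
    by (simp_all add: matrix_inv_def)
qed

text \<open>The Ricci contraction of a curvature of this shape: the first product has trace \<open>n h\<^sub>\<gamma>\<^sub>\<sigma>\<close>, the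
  second \<open>h\<^sub>\<gamma>\<^sub>\<sigma>\<close>. Symmetry of \<open>B\<close> brings the last one to the form in which an index of \<open>B\<close> is
  raised by \<open>g\<close>.\<close>

lemma contract_space_form:
  fixes h g A B :: "'k::finite \<Rightarrow> 'k \<Rightarrow> complex"
  assumes right: "\<And>\<alpha> \<gamma>. (\<Sum>\<beta>\<in>UNIV. h \<alpha> \<beta> * g \<gamma> \<beta>) = (if \<alpha> = \<gamma> then 1 else 0)"
    and left: "\<And>\<beta> \<sigma>. (\<Sum>\<alpha>\<in>UNIV. g \<alpha> \<beta> * h \<alpha> \<sigma>) = (if \<beta> = \<sigma> then 1 else 0)"
    and B: "\<And>\<beta> \<sigma>. B \<beta> \<sigma> = B \<sigma> \<beta>"
  shows "(\<Sum>\<alpha>\<in>UNIV. \<Sum>\<beta>\<in>UNIV. g \<alpha> \<beta> * (inverse n * (h \<alpha> \<beta> * h \<gamma> \<sigma> + h \<alpha> \<sigma> * h \<gamma> \<beta> - A \<alpha> \<gamma> * B \<beta> \<sigma>)))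
    = inverse n * ((of_nat CARD('k) + 1) * h \<gamma> \<sigma> - (\<Sum>\<mu>\<in>UNIV. A \<mu> \<gamma> * (\<Sum>\<tau>\<in>UNIV. B \<sigma> \<tau> * g \<mu> \<tau>)))"
proof -
  have "(\<Sum>\<alpha>\<in>UNIV. \<Sum>\<beta>\<in>UNIV. g \<alpha> \<beta> * (inverse n * (h \<alpha> \<beta> * h \<gamma> \<sigma> + h \<alpha> \<sigma> * h \<gamma> \<beta> - A \<alpha> \<gamma> * B \<beta> \<sigma>)))
    = inverse n * ((\<Sum>\<alpha>\<in>UNIV. \<Sum>\<beta>\<in>UNIV. h \<alpha> \<beta> * g \<alpha> \<beta>) * h \<gamma> \<sigma>
      + (\<Sum>\<alpha>\<in>UNIV. \<Sum>\<beta>\<in>UNIV. g \<alpha> \<beta> * h \<alpha> \<sigma> * h \<gamma> \<beta>)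
      - (\<Sum>\<alpha>\<in>UNIV. \<Sum>\<beta>\<in>UNIV. A \<alpha> \<gamma> * (B \<beta> \<sigma> * g \<alpha> \<beta>)))"
    by (simp add: sum_distrib_left sum_distrib_right sum.distrib[symmetric] sum_subtractf[symmetric] algebra_simps)
  also have "(\<Sum>\<alpha>\<in>UNIV. \<Sum>\<beta>\<in>UNIV. h \<alpha> \<beta> * g \<alpha> \<beta>) = of_nat CARD('k)"
    by (simp add: right)
  also have "(\<Sum>\<alpha>\<in>UNIV. \<Sum>\<beta>\<in>UNIV. g \<alpha> \<beta> * h \<alpha> \<sigma> * h \<gamma> \<beta>) = h \<gamma> \<sigma>"
    by (subst sum.swap) (simp add: sum_distrib_right[symmetric] left if_distrib[of "\<lambda>x. x * _"] cong: if_cong)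
  finally show ?thesis
    by (simp add: B[of _ \<sigma>] sum_distrib_left algebra_simps)
qed

lemma contract_ricci_form:
  fixes h g A B :: "'k::finite \<Rightarrow> 'k \<Rightarrow> complex"
  assumes right: "\<And>\<alpha> \<gamma>. (\<Sum>\<beta>\<in>UNIV. h \<alpha> \<beta> * g \<gamma> \<beta>) = (if \<alpha> = \<gamma> then 1 else 0)"
    and B: "\<And>\<beta> \<sigma>. B \<beta> \<sigma> = B \<sigma> \<beta>"
  shows "(\<Sum>\<gamma>\<in>UNIV. \<Sum>\<sigma>\<in>UNIV. g \<gamma> \<sigma> * (inverse n * (c * h \<gamma> \<sigma> - (\<Sum>\<mu>\<in>UNIV. A \<mu> \<gamma> * (\<Sum>\<tau>\<in>UNIV. B \<sigma> \<tau> * g \<mu> \<tau>)))))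
    = inverse n * (c * of_nat CARD('k)
      - (\<Sum>\<mu>\<in>UNIV. \<Sum>\<nu>\<in>UNIV. A \<mu> \<nu> * (\<Sum>\<beta>\<in>UNIV. \<Sum>\<sigma>\<in>UNIV. B \<beta> \<sigma> * g \<nu> \<sigma> * g \<mu> \<beta>)))"
proof -
  have "(\<Sum>\<gamma>\<in>UNIV. \<Sum>\<sigma>\<in>UNIV. g \<gamma> \<sigma> * (inverse n * (c * h \<gamma> \<sigma> - (\<Sum>\<mu>\<in>UNIV. A \<mu> \<gamma> * (\<Sum>\<tau>\<in>UNIV. B \<sigma> \<tau> * g \<mu> \<tau>)))))
    = inverse n * (c * (\<Sum>\<gamma>\<in>UNIV. \<Sum>\<sigma>\<in>UNIV. h \<gamma> \<sigma> * g \<gamma> \<sigma>)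
      - (\<Sum>\<gamma>\<in>UNIV. \<Sum>\<sigma>\<in>UNIV. \<Sum>\<mu>\<in>UNIV. \<Sum>\<tau>\<in>UNIV. A \<mu> \<gamma> * (B \<sigma> \<tau> * g \<gamma> \<sigma> * g \<mu> \<tau>)))"
    by (simp add: sum_distrib_left sum_distrib_right sum_subtractf[symmetric] right_diff_distrib mult_ac)
  also have "(\<Sum>\<gamma>\<in>UNIV. \<Sum>\<sigma>\<in>UNIV. h \<gamma> \<sigma> * g \<gamma> \<sigma>) = of_nat CARD('k)"
    by (simp add: right)
  also have "(\<Sum>\<gamma>\<in>UNIV. \<Sum>\<sigma>\<in>UNIV. \<Sum>\<mu>\<in>UNIV. \<Sum>\<tau>\<in>UNIV. A \<mu> \<gamma> * (B \<sigma> \<tau> * g \<gamma> \<sigma> * g \<mu> \<tau>))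
     = (\<Sum>\<gamma>\<in>UNIV. \<Sum>\<mu>\<in>UNIV. \<Sum>\<sigma>\<in>UNIV. \<Sum>\<tau>\<in>UNIV. A \<mu> \<gamma> * (B \<sigma> \<tau> * g \<gamma> \<sigma> * g \<mu> \<tau>))"
    by (intro sum.cong refl sum.swap)
  also have "\<dots> = (\<Sum>\<mu>\<in>UNIV. \<Sum>\<gamma>\<in>UNIV. \<Sum>\<sigma>\<in>UNIV. \<Sum>\<tau>\<in>UNIV. A \<mu> \<gamma> * (B \<sigma> \<tau> * g \<gamma> \<sigma> * g \<mu> \<tau>))"
    by (rule sum.swap)
  also have "\<dots> = (\<Sum>\<mu>\<in>UNIV. \<Sum>\<gamma>\<in>UNIV. \<Sum>\<tau>\<in>UNIV. \<Sum>\<sigma>\<in>UNIV. A \<mu> \<gamma> * (B \<tau> \<sigma> * g \<gamma> \<sigma> * g \<mu> \<tau>))"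
    by (rule sum.cong[OF refl], rule sum.cong[OF refl], subst sum.swap) (simp add: B)
  finally show ?thesis by (simp add: sum_distrib_left)
qed

section \<open>Curvature and Chern--Moser--Weyl tensor in the graph frame\<close>

context flat_tanaka_webster
begin

lemma levi_Z: "p \<in> M \<Longrightarrow> levi M theta Z \<alpha> \<beta> p = (\<Sum>j\<in>UNIV. Z \<alpha> p $ Inl j * cnj (Z \<beta> p $ Inl j))"
  by (simp add: levi_def levi_pair_theta[OF _ vfield10D(1)[OF vfield10_Z] vfield10_Z])

text \<open>The frame is linearly independent because its components along the first \<open>n\<close> axes form the
  identity matrix.\<close>

lemma levi_inv_Z:
  assumes p: "p \<in> M"
  shows "(\<Sum>\<beta>\<in>UNIV. levi M theta Z \<alpha> \<beta> p * levi_inv M theta Z \<gamma> \<beta> p) = (if \<alpha> = \<gamma> then 1 else 0)"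
    and "(\<Sum>\<alpha>\<in>UNIV. levi_inv M theta Z \<alpha> \<beta> p * levi M theta Z \<alpha> \<sigma> p) = (if \<beta> = \<sigma> then 1 else 0)"
proof -
  define H where "H = (\<chi> \<alpha> \<beta>. levi M theta Z \<alpha> \<beta> p)"
  have "\<forall>\<beta>. x \<beta> = 0" if "\<forall>j. (\<Sum>\<beta>\<in>UNIV. cnj (Z \<beta> p $ Inl j) * x \<beta>) = 0" for x :: "'n \<Rightarrow> complex"
  proof
    show "x \<beta> = 0" for \<beta>
      using that[rule_format, of "Some \<beta>"] by (simp add: Z_nth if_distrib[of cnj] if_distrib[of "\<lambda>x. x * _"] cong: if_cong)
  qed
  from Gram_matrix_invertible[of "\<lambda>\<alpha> j. Z \<alpha> p $ Inl j", OF this]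
  have inv: "H ** matrix_inv H = mat 1" "matrix_inv H ** H = mat 1"
    by (simp_all add: H_def levi_Z[OF p])
  show "(\<Sum>\<beta>\<in>UNIV. levi M theta Z \<alpha> \<beta> p * levi_inv M theta Z \<gamma> \<beta> p) = (if \<alpha> = \<gamma> then 1 else 0)"
    using arg_cong[OF inv(1), of "\<lambda>A. A $ \<alpha> $ \<gamma>"]
    by (simp add: matrix_matrix_mult_def mat_def levi_inv_def H_def)
  show "(\<Sum>\<alpha>\<in>UNIV. levi_inv M theta Z \<alpha> \<beta> p * levi M theta Z \<alpha> \<sigma> p) = (if \<beta> = \<sigma> then 1 else 0)"
    using arg_cong[OF inv(2), of "\<lambda>A. A $ \<beta> $ \<sigma>"]
    by (simp add: matrix_matrix_mult_def mat_def levi_inv_def H_def)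
qed

lemma grad_norm2_eq_N:
  assumes "p \<in> M"
  shows "grad_norm2 \<rho> p = N p"
proof -
  have "(\<chi> j k. dz j (dzbar k (cpx \<rho>)) p) = mat 1"
    using flat assms M_sub by (auto simp: vec_eq_iff mat_def)
  then have "grad_norm2 \<rho> p = (\<Sum>j\<in>UNIV. \<Sum>k\<in>UNIV. (if k = j then 1 else 0) * r j p * cnj (r k p))"
    unfolding grad_norm2_def by (simp only: matrix_inv_mat_1 dzbar_eq_r[OF assms]) (simp add: mat_def r_def)
  then show ?thesis by (simp add: N_def if_distrib[of "\<lambda>x. x * _"] cong: if_cong)
qed

lemma dz_commute: "p \<in> M \<Longrightarrow> dz j (dz k (cpx \<rho>)) p = dz k (dz j (cpx \<rho>)) p"
  using wirt_commute[OF U _ smooth_on_cpx_\<rho>, of p "Inl j" "Inl k"] M_sub by auto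

lemma D_op_symmetric: "p \<in> M \<Longrightarrow> D_op \<rho> \<alpha> \<beta> (cpx \<rho>) p = D_op \<rho> \<beta> \<alpha> (cpx \<rho>) p"
  by (simp add: D_op_def Let_def dz_commute[of p "Some \<alpha>" "Some \<beta>"] mult.commute)

text \<open>The mixed terms of \<open>D_op\<close> differ from those obtained here by the order of the two holomorphic
  derivatives.\<close>

lemma hess_Z:
  assumes p: "p \<in> M"
  shows "hess (Z \<alpha>) (Z \<gamma>) p = D_op \<rho> \<alpha> \<gamma> (cpx \<rho>) p"
proof -
  have "smooth_on U (r k)" for k
    using smooth_on_wirt[OF U smooth_on_cpx_\<rho>, of "Inl k"] by (simp add: r_def)
  then have "act M (Z \<alpha>) (r k) p = dz (Some \<alpha>) (r k) p - r (Some \<alpha>) p / r None p * dz None (r k) p" for k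
    using act_eq_smooth_on[OF p vfield10D(1)[OF vfield10_Z]]
    by (simp add: sum_Inl_Inr sum_option Z_nth if_distrib[of "\<lambda>x. x * _"] cong: if_cong)
  then have "hess (Z \<alpha>) (Z \<gamma>) p
     = dz (Some \<alpha>) (r (Some \<gamma>)) p - r (Some \<alpha>) p / r None p * dz None (r (Some \<gamma>)) p
       - (dz (Some \<alpha>) (r None) p - r (Some \<alpha>) p / r None p * dz None (r None) p) * (r (Some \<gamma>) p / r None p)"
    by (simp add: hess_def sum_option Z_nth if_distrib[of "\<lambda>x. _ * x"] cong: if_cong)
  moreover have "dz (Some \<alpha>) (r None) p = dz None (r (Some \<alpha>)) p"
    unfolding r_def by (rule dz_commute[OF p])
  ultimately show ?thesis
    by (simp add: D_op_def Let_def r_def[symmetric] left_diff_distrib right_diff_distrib diff_divide_distrib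
        power2_eq_square mult_ac)
qed

lemma ph_curv_Z:
  assumes p: "p \<in> M"
  shows "ph_curv M theta nab Z \<alpha> \<beta> \<gamma> \<sigma> p = inverse (N p) *
    (levi M theta Z \<alpha> \<beta> p * levi M theta Z \<gamma> \<sigma> p + levi M theta Z \<alpha> \<sigma> p * levi M theta Z \<gamma> \<beta> p
     - D_op \<rho> \<alpha> \<gamma> (cpx \<rho>) p * cnj (D_op \<rho> \<beta> \<sigma> (cpx \<rho>) p))"
  unfolding ph_curv_def levi_pair_curvature[OF vfield10_Z vfield10_Z vfield10_Z vfield10_Z p] levi_def hess_Z[OF p]
  by (simp add: divide_inverse mult.commute)

end

text \<open>With \<open>x = h\<^sub>\<alpha>\<^sub>\<beta> h\<^sub>\<gamma>\<^sub>\<sigma> + h\<^sub>\<alpha>\<^sub>\<sigma> h\<^sub>\<gamma>\<^sub>\<beta>\<close>, the terms without Hessian carry the coefficient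
  \<open>1 - 2(n+1)/(n+2) + n/(n+2) = 0\<close>: a curvature proportional to \<open>x\<close> has no tracefree part. The
  variables \<open>a\<close>, \<open>b\<close>, \<open>c\<close>, \<open>d\<close> stand for \<open>h\<^sub>\<alpha>\<^sub>\<beta>\<close>, \<open>h\<^sub>\<gamma>\<^sub>\<sigma>\<close>, \<open>h\<^sub>\<alpha>\<^sub>\<sigma>\<close>, \<open>h\<^sub>\<gamma>\<^sub>\<beta>\<close>, and the \<open>t\<close>'s
  and \<open>q\<close> for traces of the Hessian term.\<close>

lemma tracefree_part_eq:
  fixes n N :: complex
  assumes "n + 1 \<noteq> 0" "n + 2 \<noteq> 0"
  shows "inverse N * (a * b + c * d - e)
      - (inverse N * ((n + 1) * a - t1) * b + inverse N * ((n + 1) * d - t2) * c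
         + inverse N * ((n + 1) * c - t3) * d + inverse N * ((n + 1) * b - t4) * a) / (n + 2)
      + inverse N * ((n + 1) * n - q) * (a * b + c * d) / ((n + 1) * (n + 2))
    = - (e / N) + (t1 * b + t2 * c + t3 * d + t4 * a) / ((n + 2) * N) - q * (a * b + c * d) / ((n + 1) * (n + 2) * N)"
proof -
  define x where "x = a * b + c * d"
  define s where "s = t1 * b + t2 * c + t3 * d + t4 * a"
  have cancel: "2 * ((n + 1) * x) / (n + 2) = x + n * x / (n + 2)"
    using assms(2) by (simp add: field_simps)
  have scal: "((n + 1) * n - q) * x / ((n + 1) * (n + 2)) = n * x / (n + 2) - q * x / ((n + 1) * (n + 2))"
    using assms(1) by (simp add: left_diff_distrib diff_divide_distrib mult.assoc)
  have ric: "inverse N * ((n + 1) * a - t1) * b + inverse N * ((n + 1) * d - t2) * c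
         + inverse N * ((n + 1) * c - t3) * d + inverse N * ((n + 1) * b - t4) * a
      = inverse N * (2 * ((n + 1) * x) - s)"
    by (simp add: x_def s_def algebra_simps)
  have "inverse N * (x - e) - inverse N * (2 * ((n + 1) * x) - s) / (n + 2)
      + inverse N * ((n + 1) * n - q) * x / ((n + 1) * (n + 2))
    = inverse N * (x - e - (2 * ((n + 1) * x) / (n + 2) - s / (n + 2)) + ((n + 1) * n - q) * x / ((n + 1) * (n + 2)))"
    by (simp add: right_diff_distrib distrib_left diff_divide_distrib mult.assoc)
  also have "\<dots> = inverse N * (- e + s / (n + 2) - q * x / ((n + 1) * (n + 2)))"
    unfolding cancel scal by simp
  also have "inverse N * (- e + s / k - q * x / (m * k)) = - (e / N) + s / (k * N) - q * x / (m * k * N)" for k m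
    by (simp add: right_diff_distrib distrib_left divide_inverse mult_ac)
  finally show ?thesis unfolding ric x_def[symmetric] s_def[symmetric] .
qed

theorem theorem1p1:
  fixes U M :: "((complex, 'n::finite option) vec) set"
    and \<rho> :: "(complex, 'n option) vec \<Rightarrow> real"
    and \<theta> :: "'n option oneform"
    and T :: "'n option cfield"
    and nab :: "'n option connection"
  assumes "open U"
    and "smooth_on U \<rho>"
    and "M = {z \<in> U. \<rho> z = 0}"
    and "\<forall>p\<in>M. frechet_derivative \<rho> (at p) \<noteq> (\<lambda>v. 0)"
    and "\<forall>p\<in>M. dz None (cpx \<rho>) p \<noteq> 0"
    and "\<forall>z\<in>U. \<forall>j k. dz j (dzbar k (cpx \<rho>)) z = (if j = k then 1 else 0)"
    and "\<theta> = (\<lambda>p v. \<i> * (\<Sum>j\<in>UNIV. dzbar j (cpx \<rho>) p * v $ Inr j))"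
    and "reeb_field M \<rho> \<theta> T"
    and "tanaka_webster M \<rho> \<theta> T nab"
  shows "\<forall>p\<in>M. \<forall>\<alpha> \<beta> \<gamma> \<sigma>.
    (let n = of_nat CARD('n);
         Z = cr_frame \<rho>;
         N = grad_norm2 \<rho> p;
         h = (\<lambda>\<alpha> \<beta>. levi M \<theta> Z \<alpha> \<beta> p);
         h_inv = (\<lambda>\<mu> \<sigma>. levi_inv M \<theta> Z \<mu> \<sigma> p);
         h_hol = (\<lambda>\<alpha> \<beta>. D_op \<rho> \<alpha> \<beta> (cpx \<rho>) p);
         h_anti = (\<lambda>\<beta> \<sigma>. cnj (h_hol \<beta> \<sigma>));
         h_mix = (\<lambda>\<mu> \<beta>. \<Sum>\<sigma>\<in>UNIV. h_anti \<beta> \<sigma> * h_inv \<mu> \<sigma>);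
         h_up = (\<lambda>\<mu> \<nu>. \<Sum>\<beta>\<in>UNIV. \<Sum>\<sigma>\<in>UNIV. h_anti \<beta> \<sigma> * h_inv \<mu> \<sigma> * h_inv \<nu> \<beta>)
     in ph_curv M \<theta> nab Z \<alpha> \<beta> \<gamma> \<sigma> p =
          inverse N * (h \<alpha> \<beta> * h \<gamma> \<sigma> + h \<alpha> \<sigma> * h \<gamma> \<beta> - h_hol \<alpha> \<gamma> * h_anti \<beta> \<sigma>) \<and>
        chern_moser M \<theta> nab Z \<alpha> \<beta> \<gamma> \<sigma> p =
          - (h_hol \<alpha> \<gamma> * h_anti \<beta> \<sigma> / N)
          + (\<Sum>\<mu>\<in>UNIV. h_hol \<mu> \<alpha> * h_mix \<mu> \<beta> * h \<gamma> \<sigma>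
                       + h_hol \<mu> \<gamma> * h_mix \<mu> \<beta> * h \<alpha> \<sigma>
                       + h_hol \<mu> \<alpha> * h_mix \<mu> \<sigma> * h \<gamma> \<beta>
                       + h_hol \<mu> \<gamma> * h_mix \<mu> \<sigma> * h \<alpha> \<beta>) / ((n + 2) * N)
          - (\<Sum>\<mu>\<in>UNIV. \<Sum>\<nu>\<in>UNIV. h_hol \<mu> \<nu> * h_up \<nu> \<mu>) * (h \<alpha> \<beta> * h \<gamma> \<sigma> + h \<alpha> \<sigma> * h \<gamma> \<beta>)
            / ((n + 1) * (n + 2) * N))"
proof (intro ballI allI)
  fix p \<alpha> \<beta> \<gamma> \<sigma>
  assume p: "p \<in> M"
  interpret flat_hypersurface U M \<rho>
    using assms by unfold_locales auto
  have \<theta>: "\<theta> = theta" by (simp add: assms(7) theta_def fun_eq_iff)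
  interpret flat_tanaka_webster U M \<rho> T nab
    using assms(8,9) by unfold_locales (simp_all add: \<theta>)
  define n :: complex where "n = of_nat CARD('n)"
  define h where "h \<alpha> \<beta> = levi M \<theta> Z \<alpha> \<beta> p" for \<alpha> \<beta>
  define g where "g \<mu> \<sigma> = levi_inv M \<theta> Z \<mu> \<sigma> p" for \<mu> \<sigma>
  define A where "A \<alpha> \<beta> = D_op \<rho> \<alpha> \<beta> (cpx \<rho>) p" for \<alpha> \<beta>
  define mix where "mix \<mu> \<beta> = (\<Sum>\<sigma>\<in>UNIV. cnj (A \<beta> \<sigma>) * g \<mu> \<sigma>)" for \<mu> \<beta>
  define q where "q = (\<Sum>\<mu>\<in>UNIV. \<Sum>\<nu>\<in>UNIV. A \<mu> \<nu> * (\<Sum>\<beta>\<in>UNIV. \<Sum>\<sigma>\<in>UNIV. cnj (A \<beta> \<sigma>) * g \<nu> \<sigma> * g \<mu> \<beta>))"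
  have inv: "(\<Sum>\<beta>\<in>UNIV. h \<alpha> \<beta> * g \<gamma> \<beta>) = (if \<alpha> = \<gamma> then 1 else 0)"
    "(\<Sum>\<alpha>\<in>UNIV. g \<alpha> \<beta> * h \<alpha> \<sigma>) = (if \<beta> = \<sigma> then 1 else 0)" for \<alpha> \<beta> \<gamma> \<sigma>
    using levi_inv_Z[OF p] by (simp_all add: h_def g_def \<theta>)
  have sym: "cnj (A \<beta> \<sigma>) = cnj (A \<sigma> \<beta>)" for \<beta> \<sigma>
    using D_op_symmetric[OF p] by (simp add: A_def)
  have curv: "ph_curv M \<theta> nab Z \<alpha> \<beta> \<gamma> \<sigma> p = inverse (N p) * (h \<alpha> \<beta> * h \<gamma> \<sigma> + h \<alpha> \<sigma> * h \<gamma> \<beta> - A \<alpha> \<gamma> * cnj (A \<beta> \<sigma>))"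
    for \<alpha> \<beta> \<gamma> \<sigma>
    using ph_curv_Z[OF p] by (simp add: h_def A_def \<theta>)
  have ric: "ph_ricci M \<theta> nab Z \<gamma> \<sigma> p = inverse (N p) * ((n + 1) * h \<gamma> \<sigma> - (\<Sum>\<mu>\<in>UNIV. A \<mu> \<gamma> * mix \<mu> \<sigma>))" for \<gamma> \<sigma>
    unfolding ph_ricci_def curv g_def[symmetric] mix_def n_def
    by (rule contract_space_form[of h g "\<lambda>\<beta> \<sigma>. cnj (A \<beta> \<sigma>)", OF inv sym])
  have scal: "webster_scalar M \<theta> nab Z p = inverse (N p) * ((n + 1) * n - q)"
    unfolding webster_scalar_def ric g_def[symmetric] q_def mix_def n_def
    by (rule contract_ricci_form[of h g "\<lambda>\<beta> \<sigma>. cnj (A \<beta> \<sigma>)", OF inv(1) sym])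
  have n: "n + 1 \<noteq> 0" "n + 2 \<noteq> 0"
    unfolding n_def by (metis of_nat_1 of_nat_add of_nat_eq_0_iff add_is_0 one_neq_zero,
        metis of_nat_numeral of_nat_add of_nat_eq_0_iff add_is_0 zero_neq_numeral)
  have chern: "chern_moser M \<theta> nab Z \<alpha> \<beta> \<gamma> \<sigma> p =
      - (A \<alpha> \<gamma> * cnj (A \<beta> \<sigma>) / N p)
      + (\<Sum>\<mu>\<in>UNIV. A \<mu> \<alpha> * mix \<mu> \<beta> * h \<gamma> \<sigma> + A \<mu> \<gamma> * mix \<mu> \<beta> * h \<alpha> \<sigma>
           + A \<mu> \<alpha> * mix \<mu> \<sigma> * h \<gamma> \<beta> + A \<mu> \<gamma> * mix \<mu> \<sigma> * h \<alpha> \<beta>) / ((n + 2) * N p)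
      - q * (h \<alpha> \<beta> * h \<gamma> \<sigma> + h \<alpha> \<sigma> * h \<gamma> \<beta>) / ((n + 1) * (n + 2) * N p)"
    unfolding chern_moser_def Let_def n_def[symmetric] curv ric scal h_def[symmetric]
      tracefree_part_eq[OF n]
    by (simp add: sum.distrib sum_distrib_right)
  show "let n = of_nat CARD('n);
         Z = cr_frame \<rho>;
         N = grad_norm2 \<rho> p;
         h = (\<lambda>\<alpha> \<beta>. levi M \<theta> Z \<alpha> \<beta> p);
         h_inv = (\<lambda>\<mu> \<sigma>. levi_inv M \<theta> Z \<mu> \<sigma> p);
         h_hol = (\<lambda>\<alpha> \<beta>. D_op \<rho> \<alpha> \<beta> (cpx \<rho>) p);
         h_anti = (\<lambda>\<beta> \<sigma>. cnj (h_hol \<beta> \<sigma>));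
         h_mix = (\<lambda>\<mu> \<beta>. \<Sum>\<sigma>\<in>UNIV. h_anti \<beta> \<sigma> * h_inv \<mu> \<sigma>);
         h_up = (\<lambda>\<mu> \<nu>. \<Sum>\<beta>\<in>UNIV. \<Sum>\<sigma>\<in>UNIV. h_anti \<beta> \<sigma> * h_inv \<mu> \<sigma> * h_inv \<nu> \<beta>)
     in ph_curv M \<theta> nab Z \<alpha> \<beta> \<gamma> \<sigma> p =
          inverse N * (h \<alpha> \<beta> * h \<gamma> \<sigma> + h \<alpha> \<sigma> * h \<gamma> \<beta> - h_hol \<alpha> \<gamma> * h_anti \<beta> \<sigma>) \<and>
        chern_moser M \<theta> nab Z \<alpha> \<beta> \<gamma> \<sigma> p =
          - (h_hol \<alpha> \<gamma> * h_anti \<beta> \<sigma> / N)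
          + (\<Sum>\<mu>\<in>UNIV. h_hol \<mu> \<alpha> * h_mix \<mu> \<beta> * h \<gamma> \<sigma>
                       + h_hol \<mu> \<gamma> * h_mix \<mu> \<beta> * h \<alpha> \<sigma>
                       + h_hol \<mu> \<alpha> * h_mix \<mu> \<sigma> * h \<gamma> \<beta>
                       + h_hol \<mu> \<gamma> * h_mix \<mu> \<sigma> * h \<alpha> \<beta>) / ((n + 2) * N)
          - (\<Sum>\<mu>\<in>UNIV. \<Sum>\<nu>\<in>UNIV. h_hol \<mu> \<nu> * h_up \<nu> \<mu>) * (h \<alpha> \<beta> * h \<gamma> \<sigma> + h \<alpha> \<sigma> * h \<gamma> \<beta>)
            / ((n + 1) * (n + 2) * N)"
    using curv[of \<alpha> \<beta> \<gamma> \<sigma>] chern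
    unfolding Let_def grad_norm2_eq_N[OF p] h_def A_def mix_def g_def q_def n_def by blast
qed

end
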